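(* There exist universal constants $0<c\le C<\infty$ such that the following holds. Let $n\ge 1$ be an integer, and for each $i\in\{1,\dots,n\}$ let $P_i,Q_i$ be arbitrary probability measures on a measurable space $(\mathsf X_i,\mathcal F_i)$. Let $\mathbf P=\bigotimes_{i=1}^n P_i$ and $\mathbf Q=\bigotimes_{i=1}^n Q_i$. Let $M_i=\frac{P_i+Q_i}{2}$, let $u_i=\frac{\mathrm d(P_i-Q_i)}{\mathrm d(P_i+Q_i)}$, let $X_1,\dots,X_n$ be independent random variables with $X_i\sim M_i$, and set $U_i=u_i(X_i)$. Then $$ c\,\min\Bigl\{1,\mathbb E\Bigl(\sum_{i=1}^n U_i^2\Bigr)^{1/2}\Bigr\} \le \mathrm{TV}(\mathbf P,\mathbf Q)\le C\,\min\Bigl\{1,\mathbb E\Bigl(\sum_{i=1}^n U_i^2\Bigr)^{1/2}\Bigr\}. $$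
   Context: For probability measures $P,Q$ on a measurable space $(\mathsf X,\mathcal F)$, the total variation distance is $\mathrm{TV}(P,Q):=\sup_{B\in\mathcal F}|P(B)-Q(B)|$. The function $u_i=\frac{\mathrm d(P_i-Q_i)}{\mathrm d(P_i+Q_i)}$ is the Radon–Nikodym derivative of the signed measure $P_i-Q_i$ with respect to the measure $P_i+Q_i$ (if $P_i,Q_i$ have densities or mass functions $p_i,q_i$, then $u_i=(p_i-q_i)/(p_i+q_i)$ with $0/0:=0$). "Universal constants" means that $c,C$ do not depend on $n$, on the spaces, or on the measures. *)

theory Defs
  imports "HOL-Probability.Probability"
begin

text \<open>\<open>P\<close> and \<open>Q\<close> are meant to live on the same measurable space, i.e. \<open>sets Q = sets P\<close>. The
  supremum is taken in the reals: it is over a nonempty set, bounded when \<open>P\<close> and \<open>Q\<close> are finite.\<close>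

definition total_variation :: "'a measure \<Rightarrow> 'a measure \<Rightarrow> real" where
  "total_variation P Q = (SUP B\<in>sets P. \<bar>measure P B - measure Q B\<bar>)"

definition sum_measure :: "'a measure \<Rightarrow> 'a measure \<Rightarrow> 'a measure" where
  "sum_measure P Q = measure_of (space P) (sets P) (\<lambda>A. emeasure P A + emeasure Q A)"

definition avg_measure :: "'a measure \<Rightarrow> 'a measure \<Rightarrow> 'a measure" where
  "avg_measure P Q = scale_measure (1 / 2) (sum_measure P Q)"

text \<open>\<open>u\<close> is a version of the Radon--Nikodym derivative of the signed measure \<open>P - Q\<close> with respect
  to \<open>R\<close>. Such a \<open>u\<close> is determined only up to an \<open>R\<close>-null set, hence a predicate.\<close>

definition is_signed_RN_deriv ::
    "'a measure \<Rightarrow> 'a measure \<Rightarrow> 'a measure \<Rightarrow> ('a \<Rightarrow> real) \<Rightarrow> bool" where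
  "is_signed_RN_deriv R P Q u \<longleftrightarrow>
     integrable R u \<and>
     (\<forall>A\<in>sets R. measure P A - measure Q A = set_lebesgue_integral R A u)"

lemma space_sum_measure [simp]: "space (sum_measure P Q) = space P"
  and sets_sum_measure [simp, measurable_cong]: "sets (sum_measure P Q) = sets P"
  by (simp_all add: sum_measure_def)

text \<open>\<open>measure_of\<close> yields the intended values only if the set function is a measure.\<close>

lemma emeasure_sum_measure:
  assumes "sets Q = sets P" "A \<in> sets P"
  shows "emeasure (sum_measure P Q) A = emeasure P A + emeasure Q A"
  unfolding sum_measure_def
proof (rule emeasure_measure_of_sigma)
  show "sigma_algebra (space P) (sets P)" ..
  show "positive (sets P) (\<lambda>A. emeasure P A + emeasure Q A)"
    by (simp add: positive_def)
  show "countably_additive (sets P) (\<lambda>A. emeasure P A + emeasure Q A)"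
  proof (rule countably_additiveI)
    fix F :: "nat \<Rightarrow> 'a set"
    assume F: "range F \<subseteq> sets P" "disjoint_family F"
    have "(\<Sum>i. emeasure P (F i) + emeasure Q (F i))
        = (\<Sum>i. emeasure P (F i)) + (\<Sum>i. emeasure Q (F i))"
      by (rule suminf_add[symmetric]) auto
    also have "\<dots> = emeasure P (\<Union>i. F i) + emeasure Q (\<Union>i. F i)"
      using F assms(1) by (simp add: suminf_emeasure)
    finally show "(\<Sum>i. emeasure P (F i) + emeasure Q (F i))
        = emeasure P (\<Union>i. F i) + emeasure Q (\<Union>i. F i)" .
  qed
qed (use assms in auto)

lemma prob_space_avg_measure:
  assumes "prob_space P" "prob_space Q" "sets Q = sets P"
  shows "prob_space (avg_measure P Q)"
proof (rule prob_spaceI)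
  have "emeasure P (space P) = 1" "emeasure Q (space P) = 1"
    using prob_space.emeasure_space_1[OF assms(1)] prob_space.emeasure_space_1[OF assms(2)]
      sets_eq_imp_space_eq[OF assms(3)] by simp_all
  moreover have "(1 / 2 :: ennreal) * 2 = 1"
    by (subst mult.commute) (simp add: ennreal_times_divide)
  ultimately show "emeasure (avg_measure P Q) (space (avg_measure P Q)) = 1"
    by (simp add: avg_measure_def space_scale_measure emeasure_sum_measure[OF assms(3)])
qed

lemma signed_RN_deriv_exists:
  assumes P: "finite_measure P" and Q: "finite_measure Q" and s: "sets Q = sets P"
  shows "\<exists>u. is_signed_RN_deriv (sum_measure P Q) P Q u"
proof -
  let ?R = "sum_measure P Q"
  have sp: "space Q = space P"
    using s by (rule sets_eq_imp_space_eq)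
  have R: "finite_measure ?R"
  proof
    show "emeasure ?R (space ?R) \<noteq> \<infinity>"
      using finite_measure.emeasure_finite[OF P] finite_measure.emeasure_finite[OF Q]
      by (simp add: emeasure_sum_measure[OF s])
  qed
  interpret R: finite_measure ?R by (rule R)
  have dens: "\<exists>f. integrable ?R f \<and> (\<forall>A\<in>sets ?R. measure N A = set_lebesgue_integral ?R A f)"
    if N: "finite_measure N" "sets N = sets P" "\<And>A. A \<in> sets P \<Longrightarrow> emeasure N A \<le> emeasure ?R A"
    for N :: "'a measure"
  proof -
    have ac: "absolutely_continuous ?R N"
      unfolding absolutely_continuous_def null_sets_def using N(2,3) by fastforce
    have sR: "sets N = sets ?R" using N(2) by simp
    obtain D where D: "D \<in> borel_measurable ?R" "AE x in ?R. RN_deriv ?R N x = ennreal (D x)"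
      "\<And>x. 0 \<le> D x"
      using R.real_RN_deriv[OF N(1) ac sR] by metis
    have em: "emeasure N A = (\<integral>\<^sup>+x. ennreal (indicator A x * D x) \<partial>?R)" if A: "A \<in> sets ?R" for A
    proof -
      have "emeasure N A = emeasure (density ?R (RN_deriv ?R N)) A"
        using R.density_RN_deriv[OF ac sR] by simp
      also have "\<dots> = (\<integral>\<^sup>+x. RN_deriv ?R N x * indicator A x \<partial>?R)"
        using A by (simp add: emeasure_density)
      also have "\<dots> = (\<integral>\<^sup>+x. ennreal (indicator A x * D x) \<partial>?R)"
        using D(2) by (intro nn_integral_cong_AE) (auto split: split_indicator)
      finally show ?thesis .
    qed
    have "integrable ?R D"
    proof (rule integrableI_nonneg)
      have "(\<integral>\<^sup>+x. ennreal (D x) \<partial>?R) = (\<integral>\<^sup>+x. ennreal (indicator (space ?R) x * D x) \<partial>?R)"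
        by (intro nn_integral_cong) (auto split: split_indicator)
      also have "\<dots> = emeasure N (space ?R)" by (rule em[symmetric]) simp
      also have "\<dots> < \<infinity>"
        using finite_measure.emeasure_finite[OF N(1)] by (simp add: top.not_eq_extremum)
      finally show "(\<integral>\<^sup>+x. ennreal (D x) \<partial>?R) < \<infinity>" .
    qed (use D in auto)
    moreover have "measure N A = set_lebesgue_integral ?R A D" if A: "A \<in> sets ?R" for A
    proof -
      have "set_lebesgue_integral ?R A D = enn2real (\<integral>\<^sup>+x. ennreal (indicator A x * D x) \<partial>?R)"
        unfolding set_lebesgue_integral_def real_scaleR_def
        by (rule integral_eq_nn_integral) (use A D in auto)
      then show ?thesis by (simp add: em[OF A] measure_def)
    qed
    ultimately show ?thesis by blast
  qed
  obtain f where f: "integrable ?R f" "\<forall>A\<in>sets ?R. measure P A = set_lebesgue_integral ?R A f"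
    using dens[OF P refl] by (auto simp: emeasure_sum_measure[OF s])
  obtain g where g: "integrable ?R g" "\<forall>A\<in>sets ?R. measure Q A = set_lebesgue_integral ?R A g"
    using dens[OF Q s] by (auto simp: emeasure_sum_measure[OF s])
  have "is_signed_RN_deriv ?R P Q (\<lambda>x. f x - g x)"
    unfolding is_signed_RN_deriv_def
  proof (intro conjI ballI)
    fix A assume A: "A \<in> sets ?R"
    have "set_integrable ?R A f" "set_integrable ?R A g"
      using A f(1) g(1) unfolding set_integrable_def
      by (blast intro: integrable_mult_indicator)+
    then show "measure P A - measure Q A = (LINT x:A|?R. f x - g x)"
      using f(2) g(2) A by (simp add: set_integral_diff)
  qed (use f g in auto)
  then show ?thesis by blast
qed

text \<open>Types cannot be quantified inside a HOL proposition. Constants that are existentially quantified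
  in a statement with a type variable for the underlying spaces may therefore depend on the
  instance of that variable. Confining them to a fixed compact interval of positive reals, as the
  theorem does, makes them uniform in the type as well: the endpoints themselves then serve for
  every type. The values of the endpoints are not optimised.\<close>

end

theory Submission
  imports Defs
begin

text \<open>
  Write \<open>M\<^sub>i = (P\<^sub>i + Q\<^sub>i) / 2\<close>. Then \<open>P\<^sub>i\<close> and \<open>Q\<^sub>i\<close> have the densities \<open>1 + u\<^sub>i\<close> and \<open>1 - u\<^sub>i\<close> with respect to
  \<open>M\<^sub>i\<close>, so that \<open>\<bar>u\<^sub>i\<bar> \<le> 1\<close> almost everywhere, and the total variation distance of the products is
  \<open>E \<bar>\<Prod>(1 + U\<^sub>i) - \<Prod>(1 - U\<^sub>i)\<bar> / 2\<close> with independent centred variables \<open>U\<^sub>i\<close> in \<open>[-1, 1]\<close>. The theorem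
  is therefore a two-sided estimate of this expectation in terms of \<open>m = E (\<Sum>U\<^sub>i\<^sup>2)\<^bsup>1/2\<^esup>\<close>. Both
  directions truncate the \<open>U\<^sub>i\<close> at a level \<open>t\<close> comparable to \<open>m\<close>; below that level sums of the \<open>U\<^sub>i\<close>
  behave as in \<open>L\<^sup>2\<close>, above it as in \<open>L\<^sup>1\<close>.

  Lower bound. Let \<open>\<phi>\<close> clip to \<open>[-t, t]\<close>, and let \<open>\<sigma> = \<Sum>E (U\<^sub>i \<phi>(U\<^sub>i))\<close>, a sum of
  \<open>E min(U\<^sub>i\<^sup>2, t \<bar>U\<^sub>i\<bar>)\<close>. A pointwise inequality gives \<open>m \<le> \<sigma>/t + t/2\<close>, hence \<open>\<sigma> \<ge> m\<^sup>2/2\<close> for \<open>t = m\<close>.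
  The distance is tested with the centred statistic \<open>T = \<Sum>(\<phi>(U\<^sub>i) - E \<phi>(U\<^sub>i))\<close>, clipped to a window of
  half-width \<open>b\<close> of order \<open>\<surd>\<sigma> + \<sigma> + t\<close>. Passing from \<open>\<Prod>(1 - U\<^sub>i)\<close> to \<open>\<Prod>(1 + U\<^sub>i)\<close> one factor at a time,
  the expectation of the test function grows at each step \<open>k\<close> by twice a weighted expectation of
  \<open>U\<^sub>k h(A + \<phi>(U\<^sub>k))\<close>, where \<open>h\<close> is the clipping and \<open>A\<close> does not involve \<open>U\<^sub>k\<close>. As \<open>U\<^sub>k\<close> is centred and
  \<open>h \<circ> \<phi>\<close> is monotone, this is nonnegative for every value of \<open>A\<close> and equals \<open>E (U\<^sub>k \<phi>(U\<^sub>k))\<close> if \<open>A\<close> is in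
  the linear part of the window, which Chebyshev's inequality makes likely. The total growth is at
  least \<open>\<sigma>\<close>, while the test function is bounded by \<open>b\<close>: the distance is at least \<open>\<sigma>/(2b)\<close>, which is
  of order \<open>min 1 m\<close> (\<open>clip_energy_le_expectation_abs_gap\<close>, \<open>expectation_abs_gap_ge\<close>).

  Upper bound. Let \<open>m \<le> r \<le> 1/4\<close> and \<open>t = 2r\<close>. The overshoots \<open>\<bar>U\<^sub>i\<bar> 1(\<bar>U\<^sub>i\<bar> > t)\<close> have total expectation
  \<open>O(r)\<close>, and the truncated squares \<open>U\<^sub>i\<^sup>2 1(\<bar>U\<^sub>i\<bar> \<le> t)\<close> have total expectation \<open>O(r\<^sup>2)\<close>
  (\<open>expected_overshoot_le\<close>, \<open>truncated_energy_le\<close>). Replacing each \<open>U\<^sub>i\<close> by its truncated and recentred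
  version \<open>V\<^sub>i\<close> keeps all factors nonnegative and of mean one, so it changes each product by \<open>O(r)\<close> in
  \<open>L\<^sup>1\<close>; and \<open>\<Prod>(1 + V\<^sub>i) - \<Prod>(1 - V\<^sub>i)\<close> has second moment \<open>O(r\<^sup>2)\<close> by an exact computation.
\<close>

section \<open>Bounded functions of independent coordinates\<close>

locale bounded_indep_family = prob_space M for M :: "'w measure" +
  fixes U :: "'i \<Rightarrow> 'w \<Rightarrow> real" and I :: "'i set"
  assumes finite_index: "finite I"
    and indep: "indep_vars (\<lambda>_. borel) U I"
    and bounded: "i \<in> I \<Longrightarrow> \<bar>U i \<omega>\<bar> \<le> 1"
begin

lemma finite_subindex: "J \<subseteq> I \<Longrightarrow> finite J"
  using finite_index by (rule rev_finite_subset)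

text \<open>Boundedness is built in so that integrability follows from the closure rules below, without a
  separate argument for each of the many integrands. The witness \<open>g\<close> on the product space is what
  the independence of disjoint groups of coordinates applies to.\<close>

definition bdd_fun_of :: "'i set \<Rightarrow> ('w \<Rightarrow> real) \<Rightarrow> bool" where
  "bdd_fun_of J Z \<longleftrightarrow>
     (\<exists>g\<in>borel_measurable (PiM J (\<lambda>_. borel)). Z = (\<lambda>\<omega>. g (\<lambda>j\<in>J. U j \<omega>))) \<and>
     (\<exists>B. \<forall>\<omega>. \<bar>Z \<omega>\<bar> \<le> B)"

lemma bdd_fun_ofI:
  assumes "g \<in> borel_measurable (PiM J (\<lambda>_. borel))" "\<And>\<omega>. Z \<omega> = g (\<lambda>j\<in>J. U j \<omega>)"
    "\<And>\<omega>. \<bar>Z \<omega>\<bar> \<le> B"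
  shows "bdd_fun_of J Z"
  unfolding bdd_fun_of_def using assms by blast

lemma bdd_fun_of_const: "bdd_fun_of J (\<lambda>_. c)"
  by (rule bdd_fun_ofI[where g = "\<lambda>_. c" and B = "\<bar>c\<bar>"]) auto

lemma bdd_fun_of_coord:
  assumes "j \<in> J" "J \<subseteq> I" "f \<in> borel_measurable borel" "\<And>x. \<bar>x\<bar> \<le> 1 \<Longrightarrow> \<bar>f x\<bar> \<le> B"
  shows "bdd_fun_of J (\<lambda>\<omega>. f (U j \<omega>))"
proof (rule bdd_fun_ofI)
  show "(\<lambda>x. f (x j)) \<in> borel_measurable (PiM J (\<lambda>_. borel))"
    using assms(1,3) by measurable
qed (use assms bounded in auto)

lemma bdd_fun_of_binary:
  assumes h: "case_prod h \<in> borel_measurable (borel \<Otimes>\<^sub>M borel)"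
    and bd: "\<And>a b. \<exists>c. \<forall>x y. \<bar>x\<bar> \<le> a \<longrightarrow> \<bar>y\<bar> \<le> b \<longrightarrow> \<bar>h x y\<bar> \<le> c"
    and "bdd_fun_of J Y" "bdd_fun_of J Z"
  shows "bdd_fun_of J (\<lambda>\<omega>. h (Y \<omega>) (Z \<omega>))"
proof -
  from assms obtain f g a b
    where [measurable]: "f \<in> borel_measurable (PiM J (\<lambda>_. borel))"
        "g \<in> borel_measurable (PiM J (\<lambda>_. borel))"
      and eq: "Y = (\<lambda>\<omega>. f (\<lambda>j\<in>J. U j \<omega>))" "Z = (\<lambda>\<omega>. g (\<lambda>j\<in>J. U j \<omega>))"
      and ab: "\<And>\<omega>. \<bar>Y \<omega>\<bar> \<le> a" "\<And>\<omega>. \<bar>Z \<omega>\<bar> \<le> b"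
    unfolding bdd_fun_of_def by metis
  obtain c where "\<forall>x y. \<bar>x\<bar> \<le> a \<longrightarrow> \<bar>y\<bar> \<le> b \<longrightarrow> \<bar>h x y\<bar> \<le> c"
    using bd by blast
  note [measurable] = measurable_compose[OF _ h]
  have "(\<lambda>x. case_prod h (f x, g x)) \<in> borel_measurable (PiM J (\<lambda>_. borel))"
    by measurable
  then show ?thesis
    by (rule bdd_fun_ofI[where B = c])
       (use eq ab \<open>\<forall>x y. \<bar>x\<bar> \<le> a \<longrightarrow> \<bar>y\<bar> \<le> b \<longrightarrow> \<bar>h x y\<bar> \<le> c\<close> in auto)
qed

lemma bdd_fun_of_add: "bdd_fun_of J Y \<Longrightarrow> bdd_fun_of J Z \<Longrightarrow> bdd_fun_of J (\<lambda>\<omega>. Y \<omega> + Z \<omega>)"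
proof (rule bdd_fun_of_binary[where h = "(+)"])
  fix a b :: real
  show "\<exists>c. \<forall>x y. \<bar>x\<bar> \<le> a \<longrightarrow> \<bar>y\<bar> \<le> b \<longrightarrow> \<bar>x + y\<bar> \<le> c"
    by (rule exI[of _ "a + b"]) auto
qed auto

lemma bdd_fun_of_mult: "bdd_fun_of J Y \<Longrightarrow> bdd_fun_of J Z \<Longrightarrow> bdd_fun_of J (\<lambda>\<omega>. Y \<omega> * Z \<omega>)"
proof (rule bdd_fun_of_binary[where h = "(*)"])
  fix a b :: real
  show "\<exists>c. \<forall>x y. \<bar>x\<bar> \<le> a \<longrightarrow> \<bar>y\<bar> \<le> b \<longrightarrow> \<bar>x * y\<bar> \<le> c"
    by (rule exI[of _ "a * b"]) (auto simp: abs_mult intro: mult_mono order_trans[OF abs_ge_zero])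
qed auto

lemma bdd_fun_of_comp:
  assumes Z: "bdd_fun_of J Z" and h: "h \<in> borel_measurable borel"
    and bd: "\<And>a. \<exists>c. \<forall>x. \<bar>x\<bar> \<le> a \<longrightarrow> \<bar>h x\<bar> \<le> c"
  shows "bdd_fun_of J (\<lambda>\<omega>. h (Z \<omega>))"
proof (rule bdd_fun_of_binary[where h = "\<lambda>x _. h x" and Z = Z])
  fix a b :: real
  show "\<exists>c. \<forall>x y. \<bar>x\<bar> \<le> a \<longrightarrow> \<bar>y\<bar> \<le> b \<longrightarrow> \<bar>h x\<bar> \<le> c"
    using bd[of a] by blast
qed (use Z h in auto)

lemma bdd_fun_of_abs: "bdd_fun_of J Z \<Longrightarrow> bdd_fun_of J (\<lambda>\<omega>. \<bar>Z \<omega>\<bar>)"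
  by (rule bdd_fun_of_comp) auto

lemma bdd_fun_of_sqrt: "bdd_fun_of J Z \<Longrightarrow> bdd_fun_of J (\<lambda>\<omega>. sqrt (Z \<omega>))"
proof (rule bdd_fun_of_comp[where h = sqrt])
  fix a :: real
  show "\<exists>c. \<forall>x. \<bar>x\<bar> \<le> a \<longrightarrow> \<bar>sqrt x\<bar> \<le> c"
    by (rule exI[of _ "sqrt a"]) (auto simp flip: real_sqrt_minus simp: abs_le_iff)
qed auto

lemma bdd_fun_of_diff: "bdd_fun_of J Y \<Longrightarrow> bdd_fun_of J Z \<Longrightarrow> bdd_fun_of J (\<lambda>\<omega>. Y \<omega> - Z \<omega>)"
  using bdd_fun_of_add[OF _ bdd_fun_of_mult[OF bdd_fun_of_const[of _ "-1"]], of J Y Z] by simp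

lemma bdd_fun_of_power: "bdd_fun_of J Z \<Longrightarrow> bdd_fun_of J (\<lambda>\<omega>. Z \<omega> ^ k)"
  by (induction k) (auto intro: bdd_fun_of_const bdd_fun_of_mult)

lemma bdd_fun_of_divide: "bdd_fun_of J Z \<Longrightarrow> bdd_fun_of J (\<lambda>\<omega>. Z \<omega> / c)"
  using bdd_fun_of_mult[OF _ bdd_fun_of_const[of _ "inverse c"], of J Z] by (simp add: divide_inverse)

lemma bdd_fun_of_sum:
  "(\<And>i. i \<in> K \<Longrightarrow> bdd_fun_of J (Z i)) \<Longrightarrow> bdd_fun_of J (\<lambda>\<omega>. \<Sum>i\<in>K. Z i \<omega>)"
  by (induction K rule: infinite_finite_induct) (auto intro: bdd_fun_of_const bdd_fun_of_add)

lemma bdd_fun_of_prod: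
  "(\<And>i. i \<in> K \<Longrightarrow> bdd_fun_of J (Z i)) \<Longrightarrow> bdd_fun_of J (\<lambda>\<omega>. \<Prod>i\<in>K. Z i \<omega>)"
  by (induction K rule: infinite_finite_induct) (auto intro: bdd_fun_of_const bdd_fun_of_mult)

lemmas bdd_fun_of_intros = bdd_fun_of_const bdd_fun_of_add bdd_fun_of_diff bdd_fun_of_mult
  bdd_fun_of_power bdd_fun_of_divide bdd_fun_of_abs bdd_fun_of_sqrt bdd_fun_of_sum bdd_fun_of_prod

lemma random_variable_coord [measurable]: "i \<in> I \<Longrightarrow> random_variable borel (U i)"
  using indep by (auto simp: indep_vars_def2)

lemma integrable_bdd_fun_of:
  assumes "bdd_fun_of J Z" "J \<subseteq> I"
  shows "integrable M Z"
proof -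
  from assms obtain g B where g [measurable]: "g \<in> borel_measurable (PiM J (\<lambda>_. borel))"
      and Z: "Z = (\<lambda>\<omega>. g (\<lambda>j\<in>J. U j \<omega>))" and B: "\<And>\<omega>. \<bar>Z \<omega>\<bar> \<le> B"
    unfolding bdd_fun_of_def by metis
  have "(\<lambda>\<omega>. \<lambda>j\<in>J. U j \<omega>) \<in> M \<rightarrow>\<^sub>M PiM J (\<lambda>_. borel)"
    using assms(2) by (intro measurable_restrict random_variable_coord) auto
  then have "Z \<in> borel_measurable M"
    unfolding Z by measurable
  then show ?thesis
    using B by (intro integrable_const_bound[where B = B]) auto
qed

text \<open>The only form in which independence enters from here on.\<close>

lemma expectation_mult_disjoint:
  assumes "bdd_fun_of J Y" "bdd_fun_of K Z" "J \<subseteq> I" "K \<subseteq> I" "J \<inter> K = {}"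
  shows "expectation (\<lambda>\<omega>. Y \<omega> * Z \<omega>) = expectation Y * expectation Z"
proof -
  from assms obtain f g where f: "f \<in> borel_measurable (PiM J (\<lambda>_. borel))"
      and g: "g \<in> borel_measurable (PiM K (\<lambda>_. borel))"
      and eq: "Y = (\<lambda>\<omega>. f (\<lambda>j\<in>J. U j \<omega>))" "Z = (\<lambda>\<omega>. g (\<lambda>j\<in>K. U j \<omega>))"
    unfolding bdd_fun_of_def by metis
  have "indep_var borel (f \<circ> (\<lambda>\<omega>. \<lambda>j\<in>J. U j \<omega>)) borel (g \<circ> (\<lambda>\<omega>. \<lambda>j\<in>K. U j \<omega>))"
    by (rule indep_var_compose[OF indep_var_restrict[OF indep] f g]) (use assms in auto)
  then have "indep_var borel Y borel Z"
    by (simp add: eq comp_def)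
  then show ?thesis
    by (rule indep_var_lebesgue_integral) (use assms integrable_bdd_fun_of in auto)
qed

lemma integrableI_bdd: "bdd_fun_of I Z \<Longrightarrow> integrable M Z"
  by (rule integrable_bdd_fun_of) auto

lemma bdd_fun_of_mono:
  assumes "J \<subseteq> K" "bdd_fun_of J Z"
  shows "bdd_fun_of K Z"
proof -
  from assms(2) obtain g B where g: "g \<in> borel_measurable (PiM J (\<lambda>_. borel))"
      and Z: "Z = (\<lambda>\<omega>. g (\<lambda>j\<in>J. U j \<omega>))" and B: "\<And>\<omega>. \<bar>Z \<omega>\<bar> \<le> B"
    unfolding bdd_fun_of_def by metis
  have "(\<lambda>x. g (restrict x J)) \<in> borel_measurable (PiM K (\<lambda>_. borel))"
    using measurable_compose[OF measurable_restrict_subset[OF assms(1)] g] by simp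
  then show ?thesis
  proof (rule bdd_fun_ofI)
    have "restrict (\<lambda>j\<in>K. U j \<omega>) J = (\<lambda>j\<in>J. U j \<omega>)" for \<omega>
      using assms(1) by (auto simp: restrict_def fun_eq_iff)
    then show "Z \<omega> = g (restrict (\<lambda>j\<in>K. U j \<omega>) J)" for \<omega>
      by (simp add: Z)
  qed (rule B)
qed

lemma bdd_fun_of_elem: "bdd_fun_of {i} Z \<Longrightarrow> i \<in> K \<Longrightarrow> bdd_fun_of K Z"
  by (rule bdd_fun_of_mono) auto

lemma expectation_prod:
  assumes "K \<subseteq> I" "\<And>i. i \<in> K \<Longrightarrow> bdd_fun_of {i} (F i)"
  shows "expectation (\<lambda>\<omega>. \<Prod>i\<in>K. F i \<omega>) = (\<Prod>i\<in>K. expectation (F i))"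
  using finite_subindex[OF assms(1)] assms
proof (induction K)
  case (insert k K)
  have "expectation (\<lambda>\<omega>. F k \<omega> * (\<Prod>i\<in>K. F i \<omega>)) = expectation (F k) * expectation (\<lambda>\<omega>. \<Prod>i\<in>K. F i \<omega>)"
    using insert.prems insert.hyps
    by (intro expectation_mult_disjoint[of "{k}" _ K] bdd_fun_of_intros)
       (auto intro: bdd_fun_of_elem)
  then show ?case using insert by simp
qed (simp add: prob_space)

end

section \<open>Clipping, truncation and elementary inequalities\<close>

definition clip :: "real \<Rightarrow> real \<Rightarrow> real" where
  "clip t x = max (- t) (min t x)"

lemma clip_measurable [measurable]: "clip t \<in> borel_measurable borel"
  unfolding clip_def by measurable

lemma abs_clip_le: "0 \<le> t \<Longrightarrow> \<bar>clip t x\<bar> \<le> t"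
  by (auto simp: clip_def)

lemma clip_mult_self: "0 \<le> t \<Longrightarrow> 0 \<le> x * clip t x"
  by (auto simp: clip_def max_def min_def mult_nonpos_nonpos zero_le_mult_iff)

lemma clip_square_le: "0 \<le> t \<Longrightarrow> (clip t x)\<^sup>2 \<le> x * clip t x"
  by (auto simp: clip_def max_def min_def power2_eq_square mult_le_cancel_right)

text \<open>The heart of the lower bound. Here \<open>a - c\<close> is the part of the test statistic that does not involve
  \<open>u\<close>. For \<open>\<bar>a\<bar> \<le> r\<close> both arguments of the outer clipping lie in its linear part and the increment is
  \<open>clip t u\<close>. Otherwise monotonicity alone gives the increment the sign of \<open>u\<close>, and the factor
  \<open>1 - a\<^sup>2 / r\<^sup>2\<close> is negative. Having a quadratic factor in place of the indicator of \<open>\<bar>a\<bar> \<le> r\<close> builds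
  Chebyshev's inequality into the pointwise bound.\<close>

lemma clip_increment_lower_bound:
  assumes r: "0 < r" and t: "0 \<le> t" and c: "\<bar>c\<bar> \<le> t"
  shows "u * clip (r + 2 * t) (a - c) + u * clip t u * (1 - a\<^sup>2 / r\<^sup>2)
    \<le> u * clip (r + 2 * t) (a - c + clip t u)"
proof (cases "\<bar>a\<bar> \<le> r")
  case True
  have "clip (r + 2 * t) (a - c) = a - c"
    using True c t by (auto simp: clip_def)
  moreover have "clip (r + 2 * t) (a - c + clip t u) = a - c + clip t u"
    using True c t abs_clip_le[OF t, of u] by (auto simp: clip_def)
  moreover have "u * clip t u * (1 - a\<^sup>2 / r\<^sup>2) \<le> u * clip t u * 1"
    by (intro mult_left_mono clip_mult_self t) auto
  ultimately show ?thesis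
    by (simp add: distrib_left)
next
  case False
  have "1 - a\<^sup>2 / r\<^sup>2 \<le> 0"
    using False r power_mono[of r "\<bar>a\<bar>" 2] by (simp add: field_simps)
  then have "u * clip t u * (1 - a\<^sup>2 / r\<^sup>2) \<le> 0"
    by (intro mult_nonneg_nonpos clip_mult_self t)
  moreover have "u * clip (r + 2 * t) (a - c) \<le> u * clip (r + 2 * t) (a - c + clip t u)"
  proof (cases "0 \<le> u")
    case True
    then show ?thesis using t r by (intro mult_left_mono) (auto simp: clip_def)
  next
    case False
    then show ?thesis using t r by (intro mult_left_mono_neg) (auto simp: clip_def)
  qed
  ultimately show ?thesis by linarith
qed

text \<open>With \<open>y i = min ((u i)\<^sup>2 / t) \<bar>u i\<bar>\<close>, each square is at most \<open>t * y i\<close> or equal to \<open>(y i)\<^sup>2\<close>, and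
  summing leads to \<open>t * Y + Y\<^sup>2\<close>, nearly the square of \<open>Y + t / 2\<close>, for \<open>Y\<close> the sum of the \<open>y i\<close>.\<close>

lemma sqrt_sum_squares_le_clip:
  assumes fin: "finite I" and t: "0 < t"
  shows "sqrt (\<Sum>i\<in>I. (u i)\<^sup>2) \<le> (\<Sum>i\<in>I. u i * clip t (u i)) / t + t / 2"
proof -
  define y where "y i = u i * clip t (u i) / t" for i
  have y: "0 \<le> y i" for i
    using t clip_mult_self[of t "u i"] by (simp add: y_def)
  have "(u i)\<^sup>2 \<le> t * y i + (y i)\<^sup>2" for i
  proof (cases "\<bar>u i\<bar> \<le> t")
    case True
    then have "clip t (u i) = u i" by (auto simp: clip_def)
    then show ?thesis using t by (simp add: y_def power2_eq_square)
  next
    case False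
    then have "clip t (u i) = t * sgn (u i)" using t by (auto simp: clip_def sgn_if)
    then have "y i = \<bar>u i\<bar>" using t by (simp add: y_def abs_sgn)
    then show ?thesis using t by simp
  qed
  then have "(\<Sum>i\<in>I. (u i)\<^sup>2) \<le> (\<Sum>i\<in>I. t * y i + (y i)\<^sup>2)"
    by (intro sum_mono)
  also have "\<dots> = t * sum y I + (\<Sum>i\<in>I. (y i)\<^sup>2)"
    by (simp add: sum.distrib sum_distrib_left)
  also have "(\<Sum>i\<in>I. (y i)\<^sup>2) \<le> (sum y I)\<^sup>2"
    unfolding power2_eq_square sum_distrib_right using y fin
    by (intro sum_mono mult_left_mono member_le_sum) auto
  also have "t * sum y I + (sum y I)\<^sup>2 \<le> (sum y I + t / 2)\<^sup>2"
    using t by (simp add: power2_eq_square algebra_simps)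
  finally have "sqrt (\<Sum>i\<in>I. (u i)\<^sup>2) \<le> sum y I + t / 2"
    using t y by (intro real_le_lsqrt) (auto intro!: sum_nonneg add_nonneg_nonneg)
  then show ?thesis
    by (simp add: y_def[abs_def] sum_divide_distrib)
qed

text \<open>A minorant of the square root that touches it at \<open>a\<close>. It bounds the expectation of \<open>sqrt Z\<close> from
  below by the first two moments of \<open>Z\<close>.\<close>

lemma sqrt_ge_quadratic:
  fixes a z :: real
  assumes "0 < a" "0 \<le> z"
  shows "(3 * z - z\<^sup>2 / a) / (2 * sqrt a) \<le> sqrt z"
proof -
  define p b where "p = sqrt z" and "b = sqrt a"
  have p: "0 \<le> p" "z = p\<^sup>2" and b: "0 < b" "a = b\<^sup>2"
    using assms by (auto simp: p_def b_def)
  have "0 \<le> p * ((p - b)\<^sup>2 * (p + 2 * b))"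
    using p b by simp
  also have "\<dots> = 2 * p * b ^ 3 - (3 * p\<^sup>2 * b\<^sup>2 - p ^ 4)"
    by (simp add: power2_eq_square power3_eq_cube power4_eq_xxxx algebra_simps)
  finally have "3 * p\<^sup>2 * b\<^sup>2 - p ^ 4 \<le> p * (2 * b ^ 3)" by simp
  then have "(3 * p\<^sup>2 * b\<^sup>2 - p ^ 4) / (2 * b ^ 3) \<le> p"
    using b(1) by (simp add: pos_divide_le_eq)
  moreover have "(3 * p\<^sup>2 - (p\<^sup>2)\<^sup>2 / b\<^sup>2) / (2 * b) = (3 * p\<^sup>2 * b\<^sup>2 - p ^ 4) / (2 * b ^ 3)"
    using b(1) by (simp add: field_simps power2_eq_square power3_eq_cube power4_eq_xxxx)
  ultimately show ?thesis
    using b(1) p(1) unfolding p(2) b(2) by simp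
qed

lemma prod_one_plus_le_exp:
  fixes v :: "'a \<Rightarrow> real"
  assumes "\<And>i. i \<in> I \<Longrightarrow> 0 \<le> v i"
  shows "(\<Prod>i\<in>I. 1 + v i) \<le> exp (sum v I)"
proof (cases "finite I")
  case True
  have "(\<Prod>i\<in>I. 1 + v i) \<le> (\<Prod>i\<in>I. exp (v i))"
    using assms by (intro prod_mono) auto
  then show ?thesis using True by (simp add: exp_sum)
qed simp

lemma one_minus_sum_le_prod:
  fixes v :: "'a \<Rightarrow> real"
  assumes "\<And>i. i \<in> I \<Longrightarrow> 0 \<le> v i \<and> v i \<le> 1"
  shows "1 - sum v I \<le> (\<Prod>i\<in>I. 1 - v i)"
  using assms
proof (induction I rule: infinite_finite_induct)
  case (insert k I)
  have "(\<Prod>i\<in>I. 1 - v i) \<le> 1"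
    using insert.prems by (intro prod_le_1) auto
  then have "v k * (\<Prod>i\<in>I. 1 - v i) \<le> v k * 1"
    using insert.prems by (intro mult_left_mono) auto
  moreover have "1 - sum v I \<le> (\<Prod>i\<in>I. 1 - v i)"
    using insert by auto
  ultimately show ?case
    using insert.hyps by (simp add: left_diff_distrib)
qed auto

definition trunc :: "real \<Rightarrow> real \<Rightarrow> real" where
  "trunc t x = (if \<bar>x\<bar> \<le> t then x else 0)"

lemma trunc_measurable [measurable]: "trunc t \<in> borel_measurable borel"
  unfolding trunc_def[abs_def] by measurable

lemma abs_trunc_le: "\<bar>trunc t x\<bar> \<le> \<bar>x\<bar>" "0 \<le> t \<Longrightarrow> \<bar>trunc t x\<bar> \<le> t"
  by (auto simp: trunc_def)

section \<open>Products of independent factors\<close>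

context bounded_indep_family
begin

text \<open>The factors \<open>F i\<close>, of mean one, act as densities with respect to the law of the coordinates, so the left side is
  the second moment of a sum of variables that are independent with means \<open>\<mu> i\<close> after the change of
  measure. A direct induction avoids introducing that measure; it needs the first moment as well.\<close>

lemma weighted_second_moment_le:
  assumes K: "K \<subseteq> I"
    and F: "\<And>i. i \<in> K \<Longrightarrow> bdd_fun_of {i} (F i)" and G: "\<And>i. i \<in> K \<Longrightarrow> bdd_fun_of {i} (G i)"
    and F1: "\<And>i. i \<in> K \<Longrightarrow> expectation (F i) = 1"
    and mu: "\<And>i. i \<in> K \<Longrightarrow> expectation (\<lambda>\<omega>. F i \<omega> * G i \<omega>) = \<mu> i"
    and q: "\<And>i. i \<in> K \<Longrightarrow> expectation (\<lambda>\<omega>. F i \<omega> * (G i \<omega>)\<^sup>2) \<le> q i"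
  shows "expectation (\<lambda>\<omega>. (\<Prod>i\<in>K. F i \<omega>) * (\<Sum>i\<in>K. G i \<omega>)\<^sup>2) \<le> (sum \<mu> K)\<^sup>2 + sum q K"
proof -
  have "expectation (\<lambda>\<omega>. (\<Prod>i\<in>K. F i \<omega>) * (\<Sum>i\<in>K. G i \<omega>)) = sum \<mu> K \<and>
    expectation (\<lambda>\<omega>. (\<Prod>i\<in>K. F i \<omega>) * (\<Sum>i\<in>K. G i \<omega>)\<^sup>2) \<le> (sum \<mu> K)\<^sup>2 + sum q K"
    using finite_subindex[OF K] assms
  proof (induction K)
    case (insert k K)
    define W where "W \<omega> = (\<Prod>i\<in>K. F i \<omega>)" for \<omega>
    define A where "A \<omega> = (\<Sum>i\<in>K. G i \<omega>)" for \<omega>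
    have sub: "K \<subseteq> I" "{k} \<subseteq> I" "K \<inter> {k} = {}" using insert by auto
    have bW: "bdd_fun_of K W" and bA: "bdd_fun_of K A"
      unfolding W_def A_def using insert.prems
      by (auto intro!: bdd_fun_of_intros intro: bdd_fun_of_elem)
    have bF: "bdd_fun_of {k} (F k)" and bG: "bdd_fun_of {k} (G k)"
      using insert.prems by auto
    note split = expectation_mult_disjoint[OF _ _ sub, symmetric]
    note intg = integrable_bdd_fun_of[OF _ insert.prems(1)]
    note ins = bdd_fun_of_mono[of K "insert k K"] bdd_fun_of_mono[of "{k}" "insert k K"]
    have EW: "expectation W = 1"
      unfolding W_def using insert.prems by (subst expectation_prod) auto
    have IH: "expectation (\<lambda>\<omega>. W \<omega> * A \<omega>) = sum \<mu> K"
      "expectation (\<lambda>\<omega>. W \<omega> * (A \<omega>)\<^sup>2) \<le> (sum \<mu> K)\<^sup>2 + sum q K"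
      using insert.IH insert.prems by (auto simp: W_def A_def)
    have int: "integrable M (\<lambda>\<omega>. W \<omega> * A \<omega> * F k \<omega>)" "integrable M (\<lambda>\<omega>. W \<omega> * (F k \<omega> * G k \<omega>))"
       "integrable M (\<lambda>\<omega>. W \<omega> * (A \<omega>)\<^sup>2 * F k \<omega>)" "integrable M (\<lambda>\<omega>. W \<omega> * A \<omega> * (F k \<omega> * G k \<omega>))"
       "integrable M (\<lambda>\<omega>. W \<omega> * (F k \<omega> * (G k \<omega>)\<^sup>2))"
      using bW bA bF bG by (auto intro!: intg bdd_fun_of_intros intro: ins)
    have "expectation (\<lambda>\<omega>. (\<Prod>i\<in>insert k K. F i \<omega>) * (\<Sum>i\<in>insert k K. G i \<omega>))
        = expectation (\<lambda>\<omega>. W \<omega> * A \<omega> * F k \<omega> + W \<omega> * (F k \<omega> * G k \<omega>))"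
      using insert.hyps by (simp add: W_def A_def algebra_simps)
    also have "\<dots> = expectation (\<lambda>\<omega>. W \<omega> * A \<omega>) * expectation (F k)
        + expectation W * expectation (\<lambda>\<omega>. F k \<omega> * G k \<omega>)"
      using bW bA bF bG int by (simp add: split bdd_fun_of_intros)
    also have "\<dots> = sum \<mu> (insert k K)"
      using insert by (simp add: IH EW)
    finally have 1: "expectation (\<lambda>\<omega>. (\<Prod>i\<in>insert k K. F i \<omega>) * (\<Sum>i\<in>insert k K. G i \<omega>)) = sum \<mu> (insert k K)" .
    have "expectation (\<lambda>\<omega>. (\<Prod>i\<in>insert k K. F i \<omega>) * (\<Sum>i\<in>insert k K. G i \<omega>)\<^sup>2)
        = expectation (\<lambda>\<omega>. W \<omega> * (A \<omega>)\<^sup>2 * F k \<omega> + 2 * (W \<omega> * A \<omega> * (F k \<omega> * G k \<omega>))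
            + W \<omega> * (F k \<omega> * (G k \<omega>)\<^sup>2))"
      using insert.hyps by (simp add: W_def A_def algebra_simps power2_eq_square)
    also have "\<dots> = expectation (\<lambda>\<omega>. W \<omega> * (A \<omega>)\<^sup>2) * expectation (F k)
        + 2 * (expectation (\<lambda>\<omega>. W \<omega> * A \<omega>) * expectation (\<lambda>\<omega>. F k \<omega> * G k \<omega>))
        + expectation W * expectation (\<lambda>\<omega>. F k \<omega> * (G k \<omega>)\<^sup>2)"
      using bW bA bF bG int by (simp add: split bdd_fun_of_intros)
    also have "\<dots> \<le> (sum \<mu> K)\<^sup>2 + sum q K + 2 * (sum \<mu> K * \<mu> k) + q k"
      using IH insert.prems by (simp add: EW add_mono)
    also have "\<dots> \<le> (sum \<mu> (insert k K))\<^sup>2 + sum q (insert k K)"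
      using insert.hyps by (simp add: power2_eq_square algebra_simps)
    finally show ?case using 1 by blast
  qed simp
  then show ?thesis
    by blast
qed

text \<open>Subadditivity of the \<open>L\<^sup>1\<close> distance of product densities: factors are exchanged one at a time, and
  the remaining ones integrate to one.\<close>

lemma expectation_abs_diff_prod_le:
  assumes K: "K \<subseteq> I"
    and F: "\<And>i. i \<in> K \<Longrightarrow> bdd_fun_of {i} (F i)" and G: "\<And>i. i \<in> K \<Longrightarrow> bdd_fun_of {i} (G i)"
    and F0: "\<And>i \<omega>. i \<in> K \<Longrightarrow> 0 \<le> F i \<omega>" and G0: "\<And>i \<omega>. i \<in> K \<Longrightarrow> 0 \<le> G i \<omega>"
    and F1: "\<And>i. i \<in> K \<Longrightarrow> expectation (F i) = 1" and G1: "\<And>i. i \<in> K \<Longrightarrow> expectation (G i) = 1"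
  shows "expectation (\<lambda>\<omega>. \<bar>(\<Prod>i\<in>K. F i \<omega>) - (\<Prod>i\<in>K. G i \<omega>)\<bar>)
    \<le> (\<Sum>i\<in>K. expectation (\<lambda>\<omega>. \<bar>F i \<omega> - G i \<omega>\<bar>))"
  using finite_subindex[OF K] assms
proof (induction K)
  case (insert k K)
  define A where "A \<omega> = (\<Prod>i\<in>K. F i \<omega>)" for \<omega>
  define B where "B \<omega> = (\<Prod>i\<in>K. G i \<omega>)" for \<omega>
  have sub: "K \<subseteq> I" "{k} \<subseteq> I" "K \<inter> {k} = {}" using insert by auto
  have bA: "bdd_fun_of K A" and bB: "bdd_fun_of K B"
    unfolding A_def B_def using insert.prems
    by (auto intro!: bdd_fun_of_intros intro: bdd_fun_of_elem)
  have bF: "bdd_fun_of {k} (F k)" and bG: "bdd_fun_of {k} (G k)"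
    using insert.prems by auto
  note split = expectation_mult_disjoint[OF _ _ sub, symmetric]
  note intg = integrable_bdd_fun_of[OF _ insert.prems(1)]
  note ins = bdd_fun_of_mono[of K "insert k K"] bdd_fun_of_mono[of "{k}" "insert k K"]
  have B0: "0 \<le> B \<omega>" and Fk: "0 \<le> F k \<omega>" for \<omega>
    using insert.prems by (auto simp: B_def intro: prod_nonneg)
  have int: "integrable M (\<lambda>\<omega>. \<bar>A \<omega> - B \<omega>\<bar> * F k \<omega>)" "integrable M (\<lambda>\<omega>. B \<omega> * \<bar>F k \<omega> - G k \<omega>\<bar>)"
      "integrable M (\<lambda>\<omega>. \<bar>F k \<omega> * A \<omega> - G k \<omega> * B \<omega>\<bar>)"
    using bA bB bF bG by (auto intro!: intg bdd_fun_of_intros intro: ins)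
  have "\<bar>F k \<omega> * A \<omega> - G k \<omega> * B \<omega>\<bar> \<le> \<bar>A \<omega> - B \<omega>\<bar> * F k \<omega> + B \<omega> * \<bar>F k \<omega> - G k \<omega>\<bar>" for \<omega>
  proof -
    have "F k \<omega> * A \<omega> - G k \<omega> * B \<omega> = (A \<omega> - B \<omega>) * F k \<omega> + B \<omega> * (F k \<omega> - G k \<omega>)"
      by (simp add: algebra_simps)
    also have "\<bar>\<dots>\<bar> \<le> \<bar>(A \<omega> - B \<omega>) * F k \<omega>\<bar> + \<bar>B \<omega> * (F k \<omega> - G k \<omega>)\<bar>"
      by (rule abs_triangle_ineq)
    finally show ?thesis using B0 Fk by (simp add: abs_mult)
  qed
  then have "expectation (\<lambda>\<omega>. \<bar>F k \<omega> * A \<omega> - G k \<omega> * B \<omega>\<bar>)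
      \<le> expectation (\<lambda>\<omega>. \<bar>A \<omega> - B \<omega>\<bar> * F k \<omega> + B \<omega> * \<bar>F k \<omega> - G k \<omega>\<bar>)"
    using int by (intro integral_mono) auto
  also have "\<dots> = expectation (\<lambda>\<omega>. \<bar>A \<omega> - B \<omega>\<bar>) * expectation (F k)
      + expectation B * expectation (\<lambda>\<omega>. \<bar>F k \<omega> - G k \<omega>\<bar>)"
    using bA bB bF bG int by (simp add: split bdd_fun_of_intros)
  also have "expectation B = 1"
    unfolding B_def using insert.prems by (subst expectation_prod) auto
  also have "expectation (F k) = 1"
    using insert.prems by auto
  also have "expectation (\<lambda>\<omega>. \<bar>A \<omega> - B \<omega>\<bar>) \<le> (\<Sum>i\<in>K. expectation (\<lambda>\<omega>. \<bar>F i \<omega> - G i \<omega>\<bar>))"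
    unfolding A_def B_def using insert.prems by (intro insert.IH) auto
  finally show ?case
    using insert.hyps by (simp add: A_def B_def algebra_simps)
qed simp

end

section \<open>The lower bound\<close>

locale centred_indep_family = bounded_indep_family +
  assumes centred: "i \<in> I \<Longrightarrow> expectation (U i) = 0"
begin

abbreviation sum_sq :: "'a \<Rightarrow> real" where
  "sum_sq \<omega> \<equiv> \<Sum>i\<in>I. (U i \<omega>)\<^sup>2"

abbreviation mean_root :: real where
  "mean_root \<equiv> expectation (\<lambda>\<omega>. sqrt (sum_sq \<omega>))"

text \<open>The difference of the two product densities.\<close>

definition gap :: "'a \<Rightarrow> real" where
  "gap \<omega> = (\<Prod>i\<in>I. 1 + U i \<omega>) - (\<Prod>i\<in>I. 1 - U i \<omega>)"

lemma bdd_fun_of_U: "i \<in> J \<Longrightarrow> J \<subseteq> I \<Longrightarrow> bdd_fun_of J (U i)"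
  by (rule bdd_fun_of_coord[where f = "\<lambda>x. x" and B = 1]) auto

lemma U_bounds: "i \<in> I \<Longrightarrow> - 1 \<le> U i \<omega>" "i \<in> I \<Longrightarrow> U i \<omega> \<le> 1"
  using bounded[of i \<omega>] by auto

text \<open>A sum of expectations of \<open>min ((U i)\<^sup>2) (t * \<bar>U i\<bar>)\<close>: the second moments of the \<open>U i\<close> below level \<open>t\<close>
  together with \<open>t\<close> times the first absolute moments above it.\<close>

definition clip_energy :: "real \<Rightarrow> real" where
  "clip_energy t = (\<Sum>i\<in>I. expectation (\<lambda>\<omega>. U i \<omega> * clip t (U i \<omega>)))"

lemma bdd_fun_of_clip:
  assumes "0 \<le> t" "i \<in> J" "J \<subseteq> I"
  shows "bdd_fun_of J (\<lambda>\<omega>. clip t (U i \<omega>))"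
  by (rule bdd_fun_of_coord[where B = t]) (use assms abs_clip_le in auto)

lemma mean_root_le_clip_energy:
  assumes t: "0 < t"
  shows "mean_root \<le> clip_energy t / t + t / 2"
proof -
  have int: "integrable M (\<lambda>\<omega>. U i \<omega> * clip t (U i \<omega>))" if "i \<in> I" for i
    using t that by (intro integrable_bdd_fun_of[of I] bdd_fun_of_intros bdd_fun_of_U bdd_fun_of_clip) auto
  have "integrable M (\<lambda>\<omega>. sqrt (sum_sq \<omega>))"
    by (intro integrable_bdd_fun_of[of I] bdd_fun_of_intros bdd_fun_of_U) auto
  then have "mean_root
      \<le> expectation (\<lambda>\<omega>. (\<Sum>i\<in>I. U i \<omega> * clip t (U i \<omega>)) / t + t / 2)"
    using int by (intro integral_mono sqrt_sum_squares_le_clip finite_index t) auto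
  also have "\<dots> = clip_energy t / t + t / 2"
    using int by (simp add: clip_energy_def prob_space)
  finally show ?thesis .
qed

text \<open>The expectation of \<open>gap\<close> times the clipped statistic \<open>h \<circ> T\<close> is at least \<open>clip_energy t\<close>, and \<open>h\<close> is
  bounded by \<open>r + 2 * t\<close>. The lower bound comes from hybrids: \<open>W J\<close> takes the factor \<open>1 + U i\<close> for \<open>i\<close> in
  \<open>J\<close> and \<open>1 - U i\<close> elsewhere, and each insertion into \<open>J\<close> gains at least the contribution of the
  inserted index. The condition on \<open>r\<close> ensures that under every hybrid the statistic, without the
  coordinate that is being exchanged, has second moment at most \<open>r\<^sup>2 / 2\<close>.\<close>

lemma clip_energy_le_expectation_abs_gap:
  assumes t: "0 < t" and r: "0 < r" and rb: "4 * clip_energy t + 2 * (clip_energy t)\<^sup>2 \<le> r\<^sup>2"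
  shows "clip_energy t \<le> (r + 2 * t) * expectation (\<lambda>\<omega>. \<bar>gap \<omega>\<bar>)"
proof -
  define e where "e i = expectation (\<lambda>\<omega>. U i \<omega> * clip t (U i \<omega>))" for i
  define c where "c i = expectation (\<lambda>\<omega>. clip t (U i \<omega>))" for i
  define T where "T \<omega> = (\<Sum>i\<in>I. clip t (U i \<omega>) - c i)" for \<omega>
  define s :: "'b set \<Rightarrow> 'b \<Rightarrow> real" where "s J i = (if i \<in> J then 1 else - 1)" for J i
  define W where "W J \<omega> = (\<Prod>i\<in>I. 1 + s J i * U i \<omega>)" for J \<omega>
  define h where "h = clip (r + 2 * t)"
  have sig: "clip_energy t = sum e I"
    by (simp add: clip_energy_def e_def)
  have t0: "0 \<le> t" using t by simp
  note bintros = bdd_fun_of_intros bdd_fun_of_U bdd_fun_of_clip[OF t0]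
  have bh: "bdd_fun_of J (\<lambda>\<omega>. h (Z \<omega>))" if "bdd_fun_of J Z" for J Z
  proof (rule bdd_fun_of_comp[OF that])
    fix a :: real
    show "\<exists>c. \<forall>x. \<bar>x\<bar> \<le> a \<longrightarrow> \<bar>h x\<bar> \<le> c"
      using abs_clip_le[of "r + 2 * t"] t r by (auto simp: h_def intro!: exI[of _ "r + 2 * t"])
  qed (simp add: h_def)
  have e0: "0 \<le> e i" for i
    unfolding e_def by (intro Bochner_Integration.integral_nonneg clip_mult_self t0)
  have cle: "\<bar>c i\<bar> \<le> t" if "i \<in> I" for i
  proof -
    have "\<bar>c i\<bar> \<le> expectation (\<lambda>\<omega>. \<bar>clip t (U i \<omega>)\<bar>)"
      unfolding c_def by (rule integral_abs_bound)
    also have "\<dots> \<le> expectation (\<lambda>_. t)"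
      using that by (intro integral_mono integrableI_bdd bintros abs_clip_le t0) auto
    finally show ?thesis by (simp add: prob_space)
  qed
  have s_eq: "\<bar>s J i\<bar> = 1" for J i by (simp add: s_def)
  have w0: "0 \<le> 1 + s J i * U i \<omega>" "1 + s J i * U i \<omega> \<le> 2" if "i \<in> I" for J i \<omega>
    using U_bounds[OF that, of \<omega>] by (auto simp: s_def)
  have step: "e k \<le> expectation (\<lambda>\<omega>. W (insert k J) \<omega> * h (T \<omega>)) - expectation (\<lambda>\<omega>. W J \<omega> * h (T \<omega>))"
    if k: "k \<in> I" and kJ: "k \<notin> J" for k J
  proof -
    define K where "K = I - {k}"
    have K: "K \<subseteq> I" "{k} \<subseteq> I" "K \<inter> {k} = {}" "k \<notin> K" "I = insert k K" "finite K"
      using k finite_index by (auto simp: K_def)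
    define F where "F i \<omega> = 1 + s J i * U i \<omega>" for i \<omega>
    define G where "G i \<omega> = clip t (U i \<omega>) - c i" for i \<omega>
    define w where "w \<omega> = (\<Prod>i\<in>K. F i \<omega>)" for \<omega>
    define A where "A \<omega> = (\<Sum>i\<in>K. G i \<omega>)" for \<omega>
    have bF: "bdd_fun_of L (F i)" and bG: "bdd_fun_of L (G i)" if "i \<in> L" "L \<subseteq> I" for i L
      unfolding F_def G_def using that by (auto intro!: bintros)
    have bw: "bdd_fun_of K w" and bA: "bdd_fun_of K A"
      unfolding w_def A_def using K(1) by (auto intro!: bdd_fun_of_intros bF bG)
    have bU: "bdd_fun_of {k} (U k)" and bC: "bdd_fun_of {k} (\<lambda>\<omega>. clip t (U k \<omega>))"
      using k by (auto intro!: bintros)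
    have toI: "bdd_fun_of I Z" if "bdd_fun_of K Z \<or> bdd_fun_of {k} Z" for Z
      using that K bdd_fun_of_mono by blast
    have bI: "bdd_fun_of I w" "bdd_fun_of I A" "bdd_fun_of I (U k)" "bdd_fun_of I (\<lambda>\<omega>. clip t (U k \<omega>))"
      using bw bA bU bC toI by auto
    have w_nonneg: "0 \<le> w \<omega>" for \<omega>
      unfolding w_def F_def using w0 K by (intro prod_nonneg) auto
    have W1: "W (insert k J) \<omega> = (1 + U k \<omega>) * w \<omega>" and W2: "W J \<omega> = (1 - U k \<omega>) * w \<omega>" for \<omega>
    proof -
      have "(\<Prod>i\<in>K. 1 + s (insert k J) i * U i \<omega>) = w \<omega>"
        unfolding w_def F_def using K(4) by (intro prod.cong refl) (auto simp: s_def)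
      then show "W (insert k J) \<omega> = (1 + U k \<omega>) * w \<omega>" "W J \<omega> = (1 - U k \<omega>) * w \<omega>"
        unfolding W_def K(5) using K kJ by (auto simp: s_def w_def F_def)
    qed
    have T: "T \<omega> = A \<omega> - c k + clip t (U k \<omega>)" for \<omega>
      unfolding T_def K(5) using K by (simp add: A_def G_def)
    have EF: "expectation (F i) = 1" if "i \<in> I" for i
      using that by (simp add: F_def[abs_def] integrableI_bdd bintros prob_space centred)
    have mu: "expectation (\<lambda>\<omega>. F i \<omega> * G i \<omega>) = s J i * e i" if "i \<in> I" for i
    proof -
      have "expectation (\<lambda>\<omega>. F i \<omega> * G i \<omega>) = expectation (\<lambda>\<omega>. clip t (U i \<omega>) - c i
          + s J i * (U i \<omega> * clip t (U i \<omega>)) - s J i * c i * U i \<omega>)"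
        by (simp add: F_def G_def algebra_simps)
      also have "\<dots> = s J i * e i"
        using that by (simp add: integrableI_bdd bintros prob_space centred e_def c_def)
      finally show ?thesis .
    qed
    have q: "expectation (\<lambda>\<omega>. F i \<omega> * (G i \<omega>)\<^sup>2) \<le> 2 * e i" if "i \<in> I" for i
    proof -
      have "expectation (\<lambda>\<omega>. F i \<omega> * (G i \<omega>)\<^sup>2) \<le> expectation (\<lambda>\<omega>. 2 * (G i \<omega>)\<^sup>2)"
        using that w0[OF that] by (intro integral_mono integrableI_bdd bintros bF bG mult_right_mono) (auto simp: F_def)
      also have "\<dots> = expectation (\<lambda>\<omega>. 2 * (clip t (U i \<omega>))\<^sup>2 - 4 * c i * clip t (U i \<omega>) + 2 * (c i)\<^sup>2)"
        by (simp add: G_def power2_diff algebra_simps)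
      also have "\<dots> = 2 * expectation (\<lambda>\<omega>. (clip t (U i \<omega>))\<^sup>2) - 2 * (c i)\<^sup>2"
        using that by (simp add: integrableI_bdd bintros prob_space c_def power2_eq_square)
      also have "\<dots> \<le> 2 * expectation (\<lambda>\<omega>. (clip t (U i \<omega>))\<^sup>2)" by simp
      also have "expectation (\<lambda>\<omega>. (clip t (U i \<omega>))\<^sup>2) \<le> e i"
        unfolding e_def using that by (intro integral_mono integrableI_bdd bintros clip_square_le t0) auto
      finally show ?thesis by simp
    qed
    have "expectation (\<lambda>\<omega>. w \<omega> * (A \<omega>)\<^sup>2) \<le> (\<Sum>i\<in>K. s J i * e i)\<^sup>2 + (\<Sum>i\<in>K. 2 * e i)"
      unfolding w_def A_def using K(1)
      by (intro weighted_second_moment_le bF bG EF mu q) auto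
    also have "(\<Sum>i\<in>K. s J i * e i)\<^sup>2 \<le> (sum e I)\<^sup>2"
    proof -
      have "\<bar>\<Sum>i\<in>K. s J i * e i\<bar> \<le> (\<Sum>i\<in>K. \<bar>s J i * e i\<bar>)" by (rule sum_abs)
      also have "\<dots> = sum e K" using e0 by (simp add: abs_mult s_eq)
      also have "\<dots> \<le> sum e I" using e0 K finite_index by (intro sum_mono2) auto
      finally show ?thesis
        by (metis abs_ge_zero power2_abs power_mono)
    qed
    also have "(\<Sum>i\<in>K. 2 * e i) \<le> 2 * sum e I"
      unfolding sum_distrib_left[symmetric] using e0 K finite_index by (intro mult_left_mono sum_mono2) auto
    finally have second: "expectation (\<lambda>\<omega>. w \<omega> * (A \<omega>)\<^sup>2) \<le> r\<^sup>2 / 2"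
      using rb by (simp add: sig)
    have Ew: "expectation w = 1"
      unfolding w_def using K(1) bF EF by (subst expectation_prod) (auto intro!: prod.neutral)
    \<comment> \<open>Chebyshev's bound under the hybrid density \<open>w\<close>, with the quadratic minorant in place of the
      indicator of the window.\<close>
    have half: "1 / 2 \<le> expectation (\<lambda>\<omega>. w \<omega> * (1 - (A \<omega>)\<^sup>2 / r\<^sup>2))"
    proof -
      have "expectation (\<lambda>\<omega>. w \<omega> * (1 - (A \<omega>)\<^sup>2 / r\<^sup>2)) = expectation (\<lambda>\<omega>. w \<omega> - w \<omega> * (A \<omega>)\<^sup>2 / r\<^sup>2)"
        by (simp add: algebra_simps)
      also have "\<dots> = 1 - expectation (\<lambda>\<omega>. w \<omega> * (A \<omega>)\<^sup>2) / r\<^sup>2"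
        using bI Ew by (simp add: integrableI_bdd bdd_fun_of_intros)
      finally show ?thesis using second r by (simp add: field_simps)
    qed
    \<comment> \<open>The summand with \<open>h (A \<omega> - c k)\<close> has expectation zero because \<open>U k\<close> is centred; it is added so that
      the pointwise bound on the increment applies.\<close>
    note split = expectation_mult_disjoint[OF _ _ K(1,2,3)]
    have "e k = 2 * (1 / 2 * e k)" by simp
    also have "\<dots> \<le> 2 * (expectation (\<lambda>\<omega>. w \<omega> * (1 - (A \<omega>)\<^sup>2 / r\<^sup>2)) * e k)"
      using half e0[of k] by (intro mult_left_mono mult_right_mono) auto
    also have "\<dots> = 2 * (expectation (\<lambda>\<omega>. (w \<omega> * h (A \<omega> - c k)) * U k \<omega>)
        + expectation (\<lambda>\<omega>. (w \<omega> * (1 - (A \<omega>)\<^sup>2 / r\<^sup>2)) * (U k \<omega> * clip t (U k \<omega>))))"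
      using bw bA bU bC k by (subst (1 2) split) (auto intro!: bdd_fun_of_intros bh simp: e_def centred)
    also have "\<dots> = 2 * expectation (\<lambda>\<omega>. (w \<omega> * h (A \<omega> - c k)) * U k \<omega>
        + (w \<omega> * (1 - (A \<omega>)\<^sup>2 / r\<^sup>2)) * (U k \<omega> * clip t (U k \<omega>)))"
      using bI by (subst Bochner_Integration.integral_add) (auto intro!: integrableI_bdd bdd_fun_of_intros bh)
    also have "\<dots> \<le> 2 * expectation (\<lambda>\<omega>. w \<omega> * (U k \<omega> * h (T \<omega>)))"
    proof (intro mult_left_mono integral_mono)
      fix \<omega>
      have "w \<omega> * (U k \<omega> * h (A \<omega> - c k) + U k \<omega> * clip t (U k \<omega>) * (1 - (A \<omega>)\<^sup>2 / r\<^sup>2))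
          \<le> w \<omega> * (U k \<omega> * h (T \<omega>))"
        unfolding h_def T using cle[OF k] w_nonneg
        by (intro mult_left_mono clip_increment_lower_bound r t0) auto
      then show "w \<omega> * h (A \<omega> - c k) * U k \<omega> + w \<omega> * (1 - (A \<omega>)\<^sup>2 / r\<^sup>2) * (U k \<omega> * clip t (U k \<omega>))
          \<le> w \<omega> * (U k \<omega> * h (T \<omega>))"
        by (simp only: algebra_simps)
    qed (use bI in \<open>auto intro!: integrableI_bdd bdd_fun_of_intros bh simp: T\<close>)
    also have "\<dots> = expectation (\<lambda>\<omega>. W (insert k J) \<omega> * h (T \<omega>) - W J \<omega> * h (T \<omega>))"
      unfolding W1 W2 by (subst integral_mult_right_zero[symmetric]) (simp add: algebra_simps)
    also have "\<dots> = expectation (\<lambda>\<omega>. W (insert k J) \<omega> * h (T \<omega>)) - expectation (\<lambda>\<omega>. W J \<omega> * h (T \<omega>))"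
      unfolding W1 W2 T using bI
      by (intro Bochner_Integration.integral_diff) (auto intro!: integrableI_bdd bdd_fun_of_intros bh)
    finally show ?thesis .
  qed
  have "sum e J \<le> expectation (\<lambda>\<omega>. W J \<omega> * h (T \<omega>)) - expectation (\<lambda>\<omega>. W {} \<omega> * h (T \<omega>))"
    if "J \<subseteq> I" for J
    using finite_subindex[OF that] that
  proof (induction J)
    case (insert k J)
    then show ?case using step[of k J] by auto
  qed simp
  from this[of I] have "sum e I \<le> expectation (\<lambda>\<omega>. W I \<omega> * h (T \<omega>)) - expectation (\<lambda>\<omega>. W {} \<omega> * h (T \<omega>))"
    by simp
  also have "\<dots> = expectation (\<lambda>\<omega>. gap \<omega> * h (T \<omega>))"
  proof -
    have bT: "bdd_fun_of I (\<lambda>\<omega>. h (T \<omega>))"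
      unfolding T_def by (intro bh bintros) auto
    have bW: "bdd_fun_of I (W J)" for J
      unfolding W_def by (intro bintros) auto
    have "gap \<omega> = W I \<omega> - W {} \<omega>" for \<omega>
      by (simp add: gap_def W_def s_def)
    then show ?thesis
      using bT bW by (simp add: left_diff_distrib integrableI_bdd bdd_fun_of_intros)
  qed
  also have "\<dots> \<le> expectation (\<lambda>\<omega>. (r + 2 * t) * \<bar>gap \<omega>\<bar>)"
  proof (intro integral_mono)
    fix \<omega>
    have "gap \<omega> * h (T \<omega>) \<le> \<bar>gap \<omega>\<bar> * \<bar>h (T \<omega>)\<bar>"
      by (metis abs_ge_self abs_mult)
    also have "\<dots> \<le> \<bar>gap \<omega>\<bar> * (r + 2 * t)"
      using r t by (intro mult_left_mono) (auto simp: h_def intro!: abs_clip_le)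
    finally show "gap \<omega> * h (T \<omega>) \<le> (r + 2 * t) * \<bar>gap \<omega>\<bar>" by (simp add: mult.commute)
  qed (unfold gap_def T_def, (intro integrableI_bdd bintros bh; auto)+)
  finally show ?thesis by (simp add: sig)
qed

text \<open>The level \<open>t = mean_root\<close> makes \<open>q = sqrt (clip_energy t)\<close> at least of order \<open>t\<close>. With the window
  \<open>r = 2 * q + 2 * q\<^sup>2\<close> the preceding lemma gives \<open>q \<le> (5 + 2 * q) * expectation (\<lambda>\<omega>. \<bar>gap \<omega>\<bar>)\<close>.\<close>

lemma expectation_abs_gap_ge:
  "min 1 mean_root / 21 \<le> expectation (\<lambda>\<omega>. \<bar>gap \<omega>\<bar>) / 2"
proof (cases "mean_root \<le> 0")
  case True
  have "0 \<le> expectation (\<lambda>\<omega>. \<bar>gap \<omega>\<bar>)" by (rule Bochner_Integration.integral_nonneg) simp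
  moreover have "min 1 mean_root \<le> 0" using True by simp
  ultimately show ?thesis by linarith
next
  case False
  define m where "m = mean_root"
  have m: "0 < m" using False by (simp add: m_def)
  define q where "q = sqrt (clip_energy m)"
  have "m \<le> clip_energy m / m + m / 2"
    using mean_root_le_clip_energy[OF m] by (simp add: m_def)
  then have ce: "m\<^sup>2 \<le> 2 * clip_energy m"
    using m by (simp add: field_simps power2_eq_square)
  then have cpos: "0 < clip_energy m"
    using m zero_less_power[OF m, of 2] by linarith
  then have q: "0 < q" and qq: "clip_energy m = q\<^sup>2" by (auto simp: q_def)
  have mq: "m \<le> (3 / 2) * q"
  proof (rule power2_le_imp_le)
    have "0 < q\<^sup>2" using q by simp
    then show "m\<^sup>2 \<le> (3 / 2 * q)\<^sup>2"
      using ce unfolding qq power_mult_distrib by (simp add: power2_eq_square)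
  qed (use q in auto)
  have "clip_energy m \<le> (2 * q + 2 * q\<^sup>2 + 2 * m) * expectation (\<lambda>\<omega>. \<bar>gap \<omega>\<bar>)"
  proof (rule clip_energy_le_expectation_abs_gap)
    have "0 \<le> q * (q * (q * 8) + q * (q * q) * 2)" using q by simp
    then show "4 * clip_energy m + 2 * (clip_energy m)\<^sup>2 \<le> (2 * q + 2 * q\<^sup>2)\<^sup>2"
      using q unfolding qq by (simp add: power2_eq_square algebra_simps)
  qed (use q m in \<open>auto intro!: add_pos_pos\<close>)
  also have "\<dots> \<le> (q * (5 + 2 * q)) * expectation (\<lambda>\<omega>. \<bar>gap \<omega>\<bar>)"
    using mq by (intro mult_right_mono) (auto simp: algebra_simps power2_eq_square intro: Bochner_Integration.integral_nonneg)
  finally have qE: "q \<le> (5 + 2 * q) * expectation (\<lambda>\<omega>. \<bar>gap \<omega>\<bar>)"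
    using q unfolding qq by (simp add: power2_eq_square mult.assoc)
  define x where "x = min 1 q"
  have x: "x \<le> 7 * expectation (\<lambda>\<omega>. \<bar>gap \<omega>\<bar>)"
  proof -
    have E0: "0 \<le> expectation (\<lambda>\<omega>. \<bar>gap \<omega>\<bar>)" by (rule Bochner_Integration.integral_nonneg) simp
    show ?thesis
    proof (cases "q \<le> 1")
      case True
      then have "(5 + 2 * q) * expectation (\<lambda>\<omega>. \<bar>gap \<omega>\<bar>) \<le> 7 * expectation (\<lambda>\<omega>. \<bar>gap \<omega>\<bar>)"
        using E0 by (intro mult_right_mono) auto
      then show ?thesis using qE True by (simp add: x_def)
    next
      case False
      have "(5 + 2 * q) * expectation (\<lambda>\<omega>. \<bar>gap \<omega>\<bar>) \<le> (7 * q) * expectation (\<lambda>\<omega>. \<bar>gap \<omega>\<bar>)"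
        using E0 False by (intro mult_right_mono) auto
      then have "q * 1 \<le> q * (7 * expectation (\<lambda>\<omega>. \<bar>gap \<omega>\<bar>))" using qE by (simp add: algebra_simps)
      then show ?thesis using q False by (simp add: x_def)
    qed
  qed
  have "min 1 m \<le> 3 / 2 * x" using mq q by (auto simp: x_def min_def)
  with x show ?thesis by (simp add: m_def)
qed

section \<open>The upper bound\<close>

lemma bdd_fun_of_trunc:
  assumes "i \<in> J" "J \<subseteq> I"
  shows "bdd_fun_of J (\<lambda>\<omega>. trunc t (U i \<omega>))"
  by (rule bdd_fun_of_coord[where B = 1]) (use assms abs_trunc_le(1) in \<open>auto intro: order_trans\<close>)

text \<open>Let \<open>Z\<close> be the sum of the truncated squares, with expectation \<open>x\<close>. Truncation at \<open>t\<close> bounds the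
  variance of \<open>Z\<close> by \<open>t\<^sup>2 * x\<close>, so \<open>Z\<close> is concentrated enough for \<open>sqrt Z\<close> to have expectation at least
  \<open>x / sqrt (x + t\<^sup>2)\<close>. As this is at most \<open>r\<close>, and \<open>t = 2 * r\<close>, the expectation \<open>x\<close> is \<open>O(r\<^sup>2)\<close>.\<close>

lemma truncated_energy_le:
  assumes r: "0 < r" "mean_root \<le> r"
  shows "(\<Sum>i\<in>I. expectation (\<lambda>\<omega>. (trunc (2 * r) (U i \<omega>))\<^sup>2)) \<le> 3 * r\<^sup>2"
proof -
  define t where "t = 2 * r"
  define Z where "Z \<omega> = (\<Sum>i\<in>I. (trunc t (U i \<omega>))\<^sup>2)" for \<omega>
  define x where "x = (\<Sum>i\<in>I. expectation (\<lambda>\<omega>. (trunc t (U i \<omega>))\<^sup>2))"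
  define a where "a = x + t\<^sup>2"
  note bintros = bdd_fun_of_intros bdd_fun_of_U bdd_fun_of_trunc
  have bZ: "bdd_fun_of I Z" unfolding Z_def by (intro bintros) auto
  have x0: "0 \<le> x" unfolding x_def by (intro sum_nonneg Bochner_Integration.integral_nonneg) auto
  have a: "0 < a" using x0 r by (auto simp: a_def t_def intro!: add_nonneg_pos)
  have Z0: "0 \<le> Z \<omega>" for \<omega> unfolding Z_def by (intro sum_nonneg) auto
  have EZ: "expectation Z = x"
    unfolding Z_def x_def by (intro Bochner_Integration.integral_sum integrableI_bdd bintros) auto
  have EZ2: "expectation (\<lambda>\<omega>. (Z \<omega>)\<^sup>2) \<le> x * a"
  proof -
    define q where "q i = t\<^sup>2 * expectation (\<lambda>\<omega>. (trunc t (U i \<omega>))\<^sup>2)" for i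
    have "expectation (\<lambda>\<omega>. (\<Prod>i\<in>I. 1) * (\<Sum>i\<in>I. (trunc t (U i \<omega>))\<^sup>2)\<^sup>2) \<le> x\<^sup>2 + sum q I"
      unfolding x_def
    proof (rule weighted_second_moment_le)
      fix i assume i: "i \<in> I"
      have "expectation (\<lambda>\<omega>. 1 * ((trunc t (U i \<omega>))\<^sup>2)\<^sup>2) \<le> expectation (\<lambda>\<omega>. t\<^sup>2 * (trunc t (U i \<omega>))\<^sup>2)"
      proof (intro integral_mono integrableI_bdd bintros i order_refl)
        fix \<omega>
        have "(trunc t (U i \<omega>))\<^sup>2 \<le> t\<^sup>2"
          using abs_trunc_le(2)[of t "U i \<omega>"] r by (metis abs_ge_zero power2_abs power_mono t_def mult_nonneg_nonneg zero_le_numeral less_imp_le)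
        then show "1 * ((trunc t (U i \<omega>))\<^sup>2)\<^sup>2 \<le> t\<^sup>2 * (trunc t (U i \<omega>))\<^sup>2"
          unfolding mult_1 power2_eq_square[of "(trunc t (U i \<omega>))\<^sup>2"] by (rule mult_right_mono) simp
      qed
      also have "\<dots> = q i" unfolding q_def by simp
      finally show "expectation (\<lambda>\<omega>. 1 * ((trunc t (U i \<omega>))\<^sup>2)\<^sup>2) \<le> q i" .
    qed (auto intro!: bintros simp: prob_space)
    also have "sum q I = t\<^sup>2 * x" by (simp add: q_def x_def sum_distrib_left)
    finally show ?thesis by (simp add: Z_def a_def power2_eq_square algebra_simps)
  qed
  have "x / sqrt a \<le> (3 * x - expectation (\<lambda>\<omega>. (Z \<omega>)\<^sup>2) / a) / (2 * sqrt a)"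
  proof -
    have "expectation (\<lambda>\<omega>. (Z \<omega>)\<^sup>2) / a \<le> x" using EZ2 a by (simp add: field_simps)
    then have "2 * x / (2 * sqrt a) \<le> (3 * x - expectation (\<lambda>\<omega>. (Z \<omega>)\<^sup>2) / a) / (2 * sqrt a)"
      using a by (intro divide_right_mono) auto
    then show ?thesis by simp
  qed
  also have "\<dots> = expectation (\<lambda>\<omega>. (3 * Z \<omega> - (Z \<omega>)\<^sup>2 / a) / (2 * sqrt a))"
    using bZ by (simp add: integrableI_bdd bdd_fun_of_intros EZ)
  also have "\<dots> \<le> expectation (\<lambda>\<omega>. sqrt (Z \<omega>))"
    using bZ Z0 a by (intro integral_mono integrableI_bdd bintros sqrt_ge_quadratic) auto
  also have "\<dots> \<le> mean_root"
  proof (intro integral_mono integrableI_bdd bintros bZ real_sqrt_le_mono)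
    fix \<omega> show "Z \<omega> \<le> sum_sq \<omega>"
      unfolding Z_def by (intro sum_mono) (simp add: abs_le_square_iff[symmetric] abs_trunc_le)
  qed auto
  finally have "x / sqrt a \<le> r" using r by simp
  then have "(x / sqrt a)\<^sup>2 \<le> r\<^sup>2"
    using x0 a by (intro power_mono) auto
  then have xx: "x\<^sup>2 \<le> r\<^sup>2 * (x + 4 * r\<^sup>2)"
    using a by (simp add: power_divide pos_divide_le_eq) (simp add: a_def t_def power_mult_distrib)
  show ?thesis
  proof (rule ccontr)
    assume "\<not> ?thesis"
    then have g: "3 * r\<^sup>2 < x" by (simp add: x_def t_def)
    have "3 * r\<^sup>2 * x \<le> x * x" "3 * r\<^sup>2 * (3 * r\<^sup>2) < x * x"
      using mult_right_mono[OF less_imp_le[OF g] x0] mult_strict_mono'[OF g g] by simp_all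
    then show False using xx zero_le_square[of x] by (simp add: power2_eq_square algebra_simps)
  qed
qed

text \<open>A coordinate above level \<open>t\<close> makes \<open>sqrt (sum_sq \<omega>)\<close> at least its absolute value. On the event
  \<open>R i \<omega> \<le> t\<close> it is the only such coordinate, so the sum over \<open>i\<close> of the overshoots on these
  events has at most one nonzero term; each event is independent of \<open>U i\<close> and has probability at least one half by Markov's inequality and \<open>t = 2 * r\<close>.\<close>

lemma expected_overshoot_le:
  assumes r: "0 < r" "mean_root \<le> r"
  shows "(\<Sum>i\<in>I. expectation (\<lambda>\<omega>. \<bar>U i \<omega> - trunc (2 * r) (U i \<omega>)\<bar>)) \<le> 2 * r"
proof -
  define t where "t = 2 * r"
  define R where "R i \<omega> = sqrt (\<Sum>j\<in>I - {i}. (U j \<omega>)\<^sup>2)" for i \<omega>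
  define h :: "real \<Rightarrow> real" where "h z = (if z \<le> t then 1 else 0)" for z
  define B where "B i \<omega> = \<bar>U i \<omega> - trunc t (U i \<omega>)\<bar>" for i \<omega>
  note bintros = bdd_fun_of_intros bdd_fun_of_U bdd_fun_of_trunc
  have bR: "bdd_fun_of (I - {i}) (R i)" "bdd_fun_of I (R i)" for i
    unfolding R_def by (auto intro!: bintros)
  have h_borel: "h \<in> borel_measurable borel" unfolding h_def[abs_def] by measurable
  have bh: "bdd_fun_of J (\<lambda>\<omega>. h (R i \<omega>))" if "bdd_fun_of J (R i)" for i J
    using that h_borel by (rule bdd_fun_of_comp) (auto simp: h_def intro!: exI[of _ 1])
  have bB: "bdd_fun_of {i} (B i)" "bdd_fun_of I (B i)" if "i \<in> I" for i
    unfolding B_def using that by (auto intro!: bintros)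
  have half: "1 / 2 \<le> expectation (\<lambda>\<omega>. h (R i \<omega>))" for i
  proof -
    have "expectation (R i) \<le> mean_root"
      unfolding R_def using finite_index
      by (intro integral_mono integrableI_bdd bintros real_sqrt_le_mono sum_mono2) auto
    then have "1 / 2 \<le> 1 - expectation (R i) / t"
      using r by (simp add: t_def field_simps)
    also have "\<dots> = expectation (\<lambda>\<omega>. 1 - R i \<omega> / t)"
      using bR by (simp add: integrableI_bdd bdd_fun_of_intros prob_space)
    also have "\<dots> \<le> expectation (\<lambda>\<omega>. h (R i \<omega>))"
    proof (intro integral_mono integrableI_bdd bdd_fun_of_intros bh bR)
      fix \<omega>
      have "0 \<le> R i \<omega>" unfolding R_def by (simp add: sum_nonneg)
      then show "1 - R i \<omega> / t \<le> h (R i \<omega>)" using r by (auto simp: h_def t_def field_simps)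
    qed
    finally show ?thesis .
  qed
  have pointwise: "(\<Sum>i\<in>I. B i \<omega> * h (R i \<omega>)) \<le> sqrt (sum_sq \<omega>)" for \<omega>
  proof (cases "\<exists>i\<in>I. B i \<omega> * h (R i \<omega>) \<noteq> 0")
    case True
    then obtain i where i: "i \<in> I" "B i \<omega> \<noteq> 0" "h (R i \<omega>) \<noteq> 0" by auto
    have Ri: "R i \<omega> \<le> t" using i(3) by (auto simp: h_def split: if_splits)
    have zero: "B j \<omega> = 0" if "j \<in> I" "j \<noteq> i" for j
    proof -
      have "\<bar>U j \<omega>\<bar> = sqrt ((U j \<omega>)\<^sup>2)" by simp
      also have "\<dots> \<le> R i \<omega>"
        unfolding R_def using that finite_index
        by (intro real_sqrt_le_mono member_le_sum) auto
      finally show ?thesis using Ri by (simp add: B_def trunc_def)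
    qed
    have "(\<Sum>j\<in>I. B j \<omega> * h (R j \<omega>)) = B i \<omega> * h (R i \<omega>)"
      using i zero finite_index by (subst sum.remove[of I i]) (auto intro!: sum.neutral)
    also have "\<dots> \<le> \<bar>U i \<omega>\<bar>"
      by (auto simp: B_def h_def trunc_def)
    also have "\<dots> = sqrt ((U i \<omega>)\<^sup>2)" by simp
    also have "\<dots> \<le> sqrt (sum_sq \<omega>)"
      using i finite_index by (intro real_sqrt_le_mono member_le_sum) auto
    finally show ?thesis .
  next
    case False
    then have "(\<Sum>i\<in>I. B i \<omega> * h (R i \<omega>)) = 0" by (intro sum.neutral) auto
    then show ?thesis by (simp add: sum_nonneg)
  qed
  have "(\<Sum>i\<in>I. expectation (B i)) = 2 * (\<Sum>i\<in>I. expectation (B i) * (1 / 2))"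
    by (simp add: sum_distrib_left)
  also have "\<dots> \<le> 2 * (\<Sum>i\<in>I. expectation (B i) * expectation (\<lambda>\<omega>. h (R i \<omega>)))"
    by (intro mult_left_mono sum_mono half Bochner_Integration.integral_nonneg) (auto simp: B_def)
  also have "\<dots> = 2 * (\<Sum>i\<in>I. expectation (\<lambda>\<omega>. B i \<omega> * h (R i \<omega>)))"
  proof (intro arg_cong[where f = "\<lambda>x. 2 * x"] sum.cong refl)
    fix i assume "i \<in> I"
    then show "expectation (B i) * expectation (\<lambda>\<omega>. h (R i \<omega>)) = expectation (\<lambda>\<omega>. B i \<omega> * h (R i \<omega>))"
      by (intro expectation_mult_disjoint[OF bB(1) bh[OF bR(1)], symmetric]) auto
  qed
  also have "\<dots> = 2 * expectation (\<lambda>\<omega>. \<Sum>i\<in>I. B i \<omega> * h (R i \<omega>))"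
    by (subst Bochner_Integration.integral_sum)
       (auto intro!: integrableI_bdd bdd_fun_of_mult bB bh bR)
  also have "\<dots> \<le> 2 * mean_root"
    by (intro mult_left_mono integral_mono pointwise integrableI_bdd bintros bB bh bR) auto
  also have "\<dots> \<le> 2 * r" using r by simp
  finally show ?thesis by (simp add: B_def[abs_def] t_def)
qed

text \<open>With \<open>v i\<close> the variance of \<open>V i\<close>, the second moment equals \<open>2 * (\<Prod>i\<in>I. 1 + v i) - 2 * (\<Prod>i\<in>I. 1 - v i)\<close>:
  the constant terms cancel, and the rest is at most a multiple of the sum of the variances.\<close>

lemma expectation_square_diff_prod_le:
  assumes V: "\<And>i. i \<in> I \<Longrightarrow> bdd_fun_of {i} (V i)"
    and V1: "\<And>i \<omega>. i \<in> I \<Longrightarrow> \<bar>V i \<omega>\<bar> \<le> 1"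
    and V0: "\<And>i. i \<in> I \<Longrightarrow> expectation (V i) = 0"
    and y: "(\<Sum>i\<in>I. expectation (\<lambda>\<omega>. (V i \<omega>)\<^sup>2)) \<le> y" "y \<le> 1"
  shows "expectation (\<lambda>\<omega>. ((\<Prod>i\<in>I. 1 + V i \<omega>) - (\<Prod>i\<in>I. 1 - V i \<omega>))\<^sup>2) \<le> 6 * y"
proof -
  define v where "v i = expectation (\<lambda>\<omega>. (V i \<omega>)\<^sup>2)" for i
  have bV: "bdd_fun_of I (V i)" if "i \<in> I" for i
    using V that by (auto intro: bdd_fun_of_elem)
  have v0: "0 \<le> v i" for i by (simp add: v_def)
  have v1: "v i \<le> 1" if "i \<in> I" for i
  proof -
    have "v i \<le> expectation (\<lambda>_. 1)"
      unfolding v_def using that V1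
      by (intro integral_mono integrableI_bdd bdd_fun_of_intros bV) (auto simp: abs_square_le_1)
    then show ?thesis by (simp add: prob_space)
  qed
  have E1: "expectation (\<lambda>\<omega>. \<Prod>i\<in>I. (1 + V i \<omega>)\<^sup>2) = (\<Prod>i\<in>I. 1 + v i)"
    and E2: "expectation (\<lambda>\<omega>. \<Prod>i\<in>I. (1 - V i \<omega>)\<^sup>2) = (\<Prod>i\<in>I. 1 + v i)"
    and E3: "expectation (\<lambda>\<omega>. \<Prod>i\<in>I. 1 - (V i \<omega>)\<^sup>2) = (\<Prod>i\<in>I. 1 - v i)"
    by (subst expectation_prod; auto intro!: bdd_fun_of_intros V prod.cong
          simp: power2_sum power2_diff integrableI_bdd bdd_fun_of_intros bV prob_space V0 v_def)+
  have "expectation (\<lambda>\<omega>. ((\<Prod>i\<in>I. 1 + V i \<omega>) - (\<Prod>i\<in>I. 1 - V i \<omega>))\<^sup>2)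
      = expectation (\<lambda>\<omega>. (\<Prod>i\<in>I. (1 + V i \<omega>)\<^sup>2) + (\<Prod>i\<in>I. (1 - V i \<omega>)\<^sup>2) - 2 * (\<Prod>i\<in>I. 1 - (V i \<omega>)\<^sup>2))"
  proof (intro Bochner_Integration.integral_cong refl)
    fix \<omega>
    have "(\<Prod>i\<in>I. 1 - (V i \<omega>)\<^sup>2) = (\<Prod>i\<in>I. 1 + V i \<omega>) * (\<Prod>i\<in>I. 1 - V i \<omega>)"
      unfolding prod.distrib[symmetric] by (intro prod.cong refl) (simp add: power2_eq_square algebra_simps)
    then show "((\<Prod>i\<in>I. 1 + V i \<omega>) - (\<Prod>i\<in>I. 1 - V i \<omega>))\<^sup>2
       = (\<Prod>i\<in>I. (1 + V i \<omega>)\<^sup>2) + (\<Prod>i\<in>I. (1 - V i \<omega>)\<^sup>2) - 2 * (\<Prod>i\<in>I. 1 - (V i \<omega>)\<^sup>2)"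
      by (simp add: power2_diff prod_power_distrib)
  qed
  also have "\<dots> = 2 * (\<Prod>i\<in>I. 1 + v i) - 2 * (\<Prod>i\<in>I. 1 - v i)"
    by (simp add: integrableI_bdd bdd_fun_of_intros bV E1 E2 E3)
  also have "\<dots> \<le> 2 * exp (sum v I) - 2 * (1 - sum v I)"
    using v0 v1 prod_one_plus_le_exp[of I v] one_minus_sum_le_prod[of I v] by (smt (verit))
  also have "\<dots> \<le> 2 * (1 + y + y\<^sup>2) - 2 * (1 - y)"
  proof -
    have "sum v I \<le> y" "0 \<le> sum v I" using y v0 by (auto simp: v_def intro: sum_nonneg)
    moreover have "exp (sum v I) \<le> exp y" using y by (simp add: v_def)
    moreover have "exp y \<le> 1 + y + y\<^sup>2"
      using calculation(1,2) y by (intro exp_bound) auto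
    ultimately have "exp (sum v I) \<le> 1 + y + y\<^sup>2" "sum v I \<le> y" by (auto intro: order_trans)
    then show ?thesis by (intro diff_mono mult_left_mono) auto
  qed
  also have "\<dots> \<le> 6 * y"
  proof -
    have "0 \<le> y" using y v0 sum_nonneg[of I v] by (force simp: v_def)
    then have "y * y \<le> 1 * y" using y by (intro mult_right_mono) auto
    then show ?thesis by (simp add: power2_eq_square)
  qed
  finally show ?thesis .
qed

text \<open>The condition \<open>r \<le> 1 / 4\<close> ensures \<open>\<bar>V i\<bar> \<le> 4 * r \<le> 1\<close>, so that \<open>1 + V i\<close> and \<open>1 - V i\<close> are densities.
  The bound \<open>r\<close> is kept apart from \<open>mean_root\<close> because it must be positive.\<close>

lemma expectation_abs_gap_le_of_small_mean_root:
  assumes r: "0 < r" "r \<le> 1 / 4" "mean_root \<le> r"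
  shows "expectation (\<lambda>\<omega>. \<bar>gap \<omega>\<bar>) \<le> 18 * r"
proof -
  define tr where "tr i \<omega> = trunc (2 * r) (U i \<omega>)" for i \<omega>
  define d where "d i = expectation (tr i)" for i
  define V where "V i \<omega> = tr i \<omega> - d i" for i \<omega>
  define L where "L = (\<Sum>i\<in>I. expectation (\<lambda>\<omega>. \<bar>U i \<omega> - tr i \<omega>\<bar>))"
  note bintros = bdd_fun_of_intros bdd_fun_of_U
  have btr: "bdd_fun_of J (tr i)" if "i \<in> J" "J \<subseteq> I" for i J
    unfolding tr_def using that by (rule bdd_fun_of_trunc)
  have bV: "bdd_fun_of J (V i)" if "i \<in> J" "J \<subseteq> I" for i J
    unfolding V_def using that by (intro bintros btr)
  have EV: "expectation (V i) = 0" if "i \<in> I" for i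
    unfolding V_def using that by (simp add: integrableI_bdd bintros btr d_def prob_space)
  have d: "\<bar>d i\<bar> \<le> expectation (\<lambda>\<omega>. \<bar>U i \<omega> - tr i \<omega>\<bar>)" "\<bar>d i\<bar> \<le> 2 * r" if "i \<in> I" for i
  proof -
    \<comment> \<open>As \<open>U i\<close> is centred, recentring the truncation costs no more than the overshoot.\<close>
    have "- d i = expectation (\<lambda>\<omega>. U i \<omega> - tr i \<omega>)"
      using that by (simp add: integrableI_bdd bintros btr centred d_def)
    then show "\<bar>d i\<bar> \<le> expectation (\<lambda>\<omega>. \<bar>U i \<omega> - tr i \<omega>\<bar>)"
      using integral_abs_bound[of M "\<lambda>\<omega>. U i \<omega> - tr i \<omega>"] by (metis abs_minus_cancel)
    have "\<bar>d i\<bar> \<le> expectation (\<lambda>\<omega>. \<bar>tr i \<omega>\<bar>)" unfolding d_def by (rule integral_abs_bound)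
    also have "\<dots> \<le> expectation (\<lambda>_. 2 * r)"
      using that r by (intro integral_mono integrableI_bdd bintros btr) (auto simp: tr_def intro!: abs_trunc_le(2))
    finally show "\<bar>d i\<bar> \<le> 2 * r" by (simp add: prob_space)
  qed
  have V1: "\<bar>V i \<omega>\<bar> \<le> 1" if "i \<in> I" for i \<omega>
    using d(2)[OF that] abs_trunc_le(2)[of "2 * r" "U i \<omega>"] r unfolding V_def tr_def by linarith
  have L: "L \<le> 2 * r"
    unfolding L_def tr_def using r by (intro expected_overshoot_le)
  have EUV: "(\<Sum>i\<in>I. expectation (\<lambda>\<omega>. \<bar>U i \<omega> - V i \<omega>\<bar>)) \<le> 4 * r"
  proof -
    have "expectation (\<lambda>\<omega>. \<bar>U i \<omega> - V i \<omega>\<bar>) \<le> 2 * expectation (\<lambda>\<omega>. \<bar>U i \<omega> - tr i \<omega>\<bar>)" if "i \<in> I" for i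
    proof -
      have "expectation (\<lambda>\<omega>. \<bar>U i \<omega> - V i \<omega>\<bar>) \<le> expectation (\<lambda>\<omega>. \<bar>U i \<omega> - tr i \<omega>\<bar> + \<bar>d i\<bar>)"
        using that by (intro integral_mono integrableI_bdd bintros btr bV) (auto simp: V_def)
      also have "\<dots> = expectation (\<lambda>\<omega>. \<bar>U i \<omega> - tr i \<omega>\<bar>) + \<bar>d i\<bar>"
        using that by (simp add: integrableI_bdd bintros btr prob_space)
      finally show ?thesis using d(1)[OF that] by simp
    qed
    then have "(\<Sum>i\<in>I. expectation (\<lambda>\<omega>. \<bar>U i \<omega> - V i \<omega>\<bar>)) \<le> 2 * L"
      unfolding L_def sum_distrib_left by (intro sum_mono)
    then show ?thesis using L by simp
  qed
  define A where "A s \<omega> = (\<Prod>i\<in>I. 1 + s * U i \<omega>)" for s :: real and \<omega>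
  define B where "B s \<omega> = (\<Prod>i\<in>I. 1 + s * V i \<omega>)" for s :: real and \<omega>
  have bA: "bdd_fun_of I (A s)" and bB: "bdd_fun_of I (B s)" for s
    unfolding A_def B_def by (auto intro!: bintros bV)
  have AB: "expectation (\<lambda>\<omega>. \<bar>A s \<omega> - B s \<omega>\<bar>) \<le> 4 * r" if s: "s = 1 \<or> s = - 1" for s
  proof -
    have "expectation (\<lambda>\<omega>. \<bar>A s \<omega> - B s \<omega>\<bar>)
        \<le> (\<Sum>i\<in>I. expectation (\<lambda>\<omega>. \<bar>(1 + s * U i \<omega>) - (1 + s * V i \<omega>)\<bar>))"
      unfolding A_def B_def
    proof (rule expectation_abs_diff_prod_le)
      fix i \<omega> assume "i \<in> I"
      then show "0 \<le> 1 + s * U i \<omega>" "0 \<le> 1 + s * V i \<omega>"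
        using s V1[of i \<omega>] bounded[of i \<omega>] by auto
    qed (auto intro!: bintros bV simp: integrableI_bdd bintros bV EV centred prob_space)
    also have "\<dots> = (\<Sum>i\<in>I. expectation (\<lambda>\<omega>. \<bar>U i \<omega> - V i \<omega>\<bar>))"
      using s by (auto simp: abs_minus_commute)
    finally show ?thesis using EUV by simp
  qed
  have B2: "expectation (\<lambda>\<omega>. (B 1 \<omega> - B (- 1) \<omega>)\<^sup>2) \<le> 6 * (3 * r\<^sup>2)"
  proof -
    have "(\<Sum>i\<in>I. expectation (\<lambda>\<omega>. (V i \<omega>)\<^sup>2)) \<le> (\<Sum>i\<in>I. expectation (\<lambda>\<omega>. (tr i \<omega>)\<^sup>2))"
    proof (rule sum_mono)
      fix i assume i: "i \<in> I"
      have "expectation (\<lambda>\<omega>. (V i \<omega>)\<^sup>2) = expectation (\<lambda>\<omega>. (tr i \<omega>)\<^sup>2 + (d i)\<^sup>2 - 2 * d i * tr i \<omega>)"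
        by (simp add: V_def power2_diff algebra_simps)
      also have "\<dots> = expectation (\<lambda>\<omega>. (tr i \<omega>)\<^sup>2) - (d i)\<^sup>2"
        using i by (simp add: integrableI_bdd bintros btr prob_space d_def power2_eq_square)
      finally show "expectation (\<lambda>\<omega>. (V i \<omega>)\<^sup>2) \<le> expectation (\<lambda>\<omega>. (tr i \<omega>)\<^sup>2)" by simp
    qed
    also have "\<dots> \<le> 3 * r\<^sup>2"
      unfolding tr_def using r by (intro truncated_energy_le)
    finally have "(\<Sum>i\<in>I. expectation (\<lambda>\<omega>. (V i \<omega>)\<^sup>2)) \<le> 3 * r\<^sup>2" .
    moreover have "3 * r\<^sup>2 \<le> 1"
      using r power_mono[of r "1/4" 2] by (simp add: power2_eq_square)
    ultimately have "expectation (\<lambda>\<omega>. ((\<Prod>i\<in>I. 1 + V i \<omega>) - (\<Prod>i\<in>I. 1 - V i \<omega>))\<^sup>2) \<le> 6 * (3 * r\<^sup>2)"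
      using V1 EV by (intro expectation_square_diff_prod_le bV) auto
    then show ?thesis by (simp add: B_def)
  qed
  have BB: "expectation (\<lambda>\<omega>. \<bar>B 1 \<omega> - B (- 1) \<omega>\<bar>) \<le> 10 * r"
  proof -
    \<comment> \<open>The arithmetic-geometric mean inequality at scale \<open>r\<close> passes from the second moment to the first.\<close>
    have "\<bar>x\<bar> \<le> x\<^sup>2 / (2 * r) + r / 2" for x
    proof -
      have "0 \<le> (\<bar>x\<bar> - r)\<^sup>2" by simp
      then have "2 * r * \<bar>x\<bar> \<le> x\<^sup>2 + r\<^sup>2" by (simp add: power2_diff mult_ac)
      then show ?thesis using r by (simp add: field_simps power2_eq_square)
    qed
    then have "expectation (\<lambda>\<omega>. \<bar>B 1 \<omega> - B (- 1) \<omega>\<bar>)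
        \<le> expectation (\<lambda>\<omega>. (B 1 \<omega> - B (- 1) \<omega>)\<^sup>2 / (2 * r) + r / 2)"
      by (intro integral_mono integrableI_bdd bintros bB)
    also have "\<dots> = expectation (\<lambda>\<omega>. (B 1 \<omega> - B (- 1) \<omega>)\<^sup>2) / (2 * r) + r / 2"
      by (simp add: integrableI_bdd bdd_fun_of_intros bB prob_space)
    also have "\<dots> \<le> 6 * (3 * r\<^sup>2) / (2 * r) + r / 2"
      using B2 r by (intro add_right_mono divide_right_mono) auto
    also have "\<dots> \<le> 10 * r" using r by (simp add: power2_eq_square)
    finally show ?thesis .
  qed
  have "expectation (\<lambda>\<omega>. \<bar>gap \<omega>\<bar>) \<le> expectation (\<lambda>\<omega>. \<bar>A 1 \<omega> - B 1 \<omega>\<bar> + \<bar>A (- 1) \<omega> - B (- 1) \<omega>\<bar> + \<bar>B 1 \<omega> - B (- 1) \<omega>\<bar>)"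
  proof (intro integral_mono integrableI_bdd bintros bA bB)
    show "bdd_fun_of I gap" unfolding gap_def by (intro bintros) auto
    show "\<bar>gap \<omega>\<bar> \<le> \<bar>A 1 \<omega> - B 1 \<omega>\<bar> + \<bar>A (- 1) \<omega> - B (- 1) \<omega>\<bar> + \<bar>B 1 \<omega> - B (- 1) \<omega>\<bar>" for \<omega>
    proof -
      have "gap \<omega> = A 1 \<omega> - A (- 1) \<omega>" by (simp add: gap_def A_def)
      then show ?thesis by linarith
    qed
  qed
  also have "\<dots> = expectation (\<lambda>\<omega>. \<bar>A 1 \<omega> - B 1 \<omega>\<bar>) + expectation (\<lambda>\<omega>. \<bar>A (- 1) \<omega> - B (- 1) \<omega>\<bar>)
      + expectation (\<lambda>\<omega>. \<bar>B 1 \<omega> - B (- 1) \<omega>\<bar>)"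
    by (simp add: integrableI_bdd bdd_fun_of_intros bA bB)
  also have "\<dots> \<le> 18 * r" using AB[of 1] AB[of "- 1"] BB by simp
  finally show ?thesis .
qed

text \<open>For \<open>mean_root \<ge> 1 / 4\<close> the trivial bound by \<open>2\<close>, the total mass of the two products, is enough.\<close>

lemma expectation_abs_gap_le:
  "expectation (\<lambda>\<omega>. \<bar>gap \<omega>\<bar>) / 2 \<le> 9 * min 1 mean_root"
proof (cases "mean_root < 1 / 4")
  case True
  have "0 \<le> mean_root" by (rule Bochner_Integration.integral_nonneg) (simp add: sum_nonneg)
  \<comment> \<open>The preceding lemma needs a positive bound, so it is applied to every \<open>r\<close> slightly above \<open>mean_root\<close>.\<close>
  have "expectation (\<lambda>\<omega>. \<bar>gap \<omega>\<bar>) / 18 \<le> mean_root"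
  proof (rule dense_ge_bounded[OF True])
    fix r assume "mean_root < r" "r < 1 / 4"
    then show "expectation (\<lambda>\<omega>. \<bar>gap \<omega>\<bar>) / 18 \<le> r"
      using expectation_abs_gap_le_of_small_mean_root[of r] \<open>0 \<le> mean_root\<close> by simp
  qed
  then show ?thesis using True by simp
next
  case False
  note bintros = bdd_fun_of_intros bdd_fun_of_U
  have "expectation (\<lambda>\<omega>. \<bar>gap \<omega>\<bar>) \<le> expectation (\<lambda>\<omega>. (\<Prod>i\<in>I. 1 + U i \<omega>) + (\<Prod>i\<in>I. 1 - U i \<omega>))"
  proof (intro integral_mono integrableI_bdd bintros)
    show "bdd_fun_of I gap" unfolding gap_def by (intro bintros) auto
    fix \<omega>
    have "0 \<le> 1 + U i \<omega>" "0 \<le> 1 - U i \<omega>" if "i \<in> I" for i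
      using U_bounds[OF that, of \<omega>] by auto
    then have "0 \<le> (\<Prod>i\<in>I. 1 + U i \<omega>)" "0 \<le> (\<Prod>i\<in>I. 1 - U i \<omega>)"
      by (auto intro: prod_nonneg)
    then show "\<bar>gap \<omega>\<bar> \<le> (\<Prod>i\<in>I. 1 + U i \<omega>) + (\<Prod>i\<in>I. 1 - U i \<omega>)" by (simp add: gap_def)
  qed auto
  also have "\<dots> = 2"
  proof -
    have "expectation (\<lambda>\<omega>. \<Prod>i\<in>I. 1 + U i \<omega>) = 1" "expectation (\<lambda>\<omega>. \<Prod>i\<in>I. 1 - U i \<omega>) = 1"
      by (subst expectation_prod; auto intro!: bintros simp: integrableI_bdd bintros centred prob_space)+
    then show ?thesis by (simp add: integrableI_bdd bintros)
  qed
  finally show ?thesis using False by simp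
qed

end

section \<open>Total variation and densities\<close>

lemma AE_nonneg_if_set_integrals_nonneg:
  fixes f :: "'a \<Rightarrow> real"
  assumes f: "integrable M f" and nonneg: "\<And>A. A \<in> sets M \<Longrightarrow> 0 \<le> (LINT x:A|M. f x)"
  shows "AE x in M. 0 \<le> f x"
proof -
  have [measurable]: "f \<in> borel_measurable M" using f by auto
  define A where "A = {x\<in>space M. f x < 0}"
  have A: "A \<in> sets M" unfolding A_def by measurable
  have int: "integrable M (\<lambda>x. indicator A x * f x)"
    using integrable_mult_indicator[OF A f] by simp
  have le: "0 \<le> - (indicator A x * f x)" for x
    by (auto simp: A_def split: split_indicator)
  have "0 \<le> (\<integral>x. indicator A x * f x \<partial>M)"
    using nonneg[OF A] by (simp add: set_lebesgue_integral_def)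
  moreover have "0 \<le> (\<integral>x. - (indicator A x * f x) \<partial>M)"
    using le by (rule Bochner_Integration.integral_nonneg)
  ultimately have "(\<integral>x. - (indicator A x * f x) \<partial>M) = 0"
    by simp
  then have "AE x in M. - (indicator A x * f x) = 0"
    using int le by (subst (asm) integral_nonneg_eq_0_iff_AE) auto
  with AE_space show ?thesis
    by eventually_elim (auto simp: A_def indicator_def not_less split: if_splits)
qed

text \<open>The clipping changes \<open>v\<close> on a null set only. It provides a density that is nonnegative
  everywhere.\<close>

lemma half_density_eq:
  assumes R: "finite_measure R" and v: "integrable R v"
    and N: "finite_measure N" "sets N = sets R"
    and eq: "\<And>A. A \<in> sets R \<Longrightarrow> 2 * measure N A = measure R A + (LINT x:A|R. v x)"
    and v1: "AE x in R. \<bar>v x\<bar> \<le> 1"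
  shows "density (scale_measure (1 / 2) R) (\<lambda>x. ennreal (1 + clip 1 (v x))) = N"
proof (rule measure_eqI)
  interpret R: finite_measure R by (rule R)
  interpret N: finite_measure N by (rule N)
  note [measurable] = borel_measurable_integrable[OF v]
  fix A assume "A \<in> sets (density (scale_measure (1 / 2) R) (\<lambda>x. ennreal (1 + clip 1 (v x))))"
  then have A [measurable]: "A \<in> sets R" by simp
  have int: "integrable R (\<lambda>x. indicator A x + indicator A x * v x)"
    using integrable_mult_indicator[OF A v] A by (simp add: less_top[symmetric])
  have "emeasure (density (scale_measure (1 / 2) R) (\<lambda>x. ennreal (1 + clip 1 (v x)))) A
      = (\<integral>\<^sup>+x. ennreal (1 + clip 1 (v x)) * indicator A x \<partial>scale_measure (1 / 2) R)"
    by (subst emeasure_density) auto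
  also have "\<dots> = (1 / 2) * (\<integral>\<^sup>+x. ennreal (1 + clip 1 (v x)) * indicator A x \<partial>R)"
    by (rule nn_integral_scale_measure) measurable
  also have "(\<integral>\<^sup>+x. ennreal (1 + clip 1 (v x)) * indicator A x \<partial>R)
      = (\<integral>\<^sup>+x. ennreal (indicator A x + indicator A x * v x) \<partial>R)"
    using v1 by (intro nn_integral_cong_AE, eventually_elim) (auto simp: clip_def split: split_indicator)
  also have "\<dots> = ennreal (\<integral>x. indicator A x + indicator A x * v x \<partial>R)"
  proof (rule nn_integral_eq_integral[OF int])
    show "AE x in R. 0 \<le> indicator A x + indicator A x * v x"
      using v1 by eventually_elim (auto split: split_indicator)
  qed
  also have "(\<integral>x. indicator A x + indicator A x * v x \<partial>R) = measure R A + (LINT x:A|R. v x)"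
    using integrable_mult_indicator[OF A v] A
    by (subst Bochner_Integration.integral_add) (auto simp: set_lebesgue_integral_def less_top[symmetric])
  also have "\<dots> = 2 * measure N A"
    using eq[OF A] by simp
  also have "(1 / 2) * ennreal (2 * measure N A) = ennreal (measure N A)"
  proof -
    have "(1 / 2 :: ennreal) = ennreal (1 / 2)" using divide_ennreal[of 1 2] by simp
    then show ?thesis by (simp only:) (subst ennreal_mult[symmetric]; simp)
  qed
  finally show "emeasure (density (scale_measure (1 / 2) R) (\<lambda>x. ennreal (1 + clip 1 (v x)))) A = emeasure N A"
    by (simp add: N.emeasure_eq_measure)
qed (use N in auto)

text \<open>For each measurable \<open>A\<close> the integral of \<open>1 + u\<close> over \<open>A\<close> with respect to \<open>P + Q\<close> is \<open>2 * measure P A\<close>, and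
  that of \<open>1 - u\<close> is \<open>2 * measure Q A\<close>. Nonnegativity of both gives \<open>\<bar>u\<bar> \<le> 1\<close> almost everywhere.\<close>

lemma signed_RN_deriv_densities:
  assumes P: "prob_space P" and Q: "prob_space Q" and s: "sets Q = sets P"
    and u: "is_signed_RN_deriv (sum_measure P Q) P Q u"
  shows "AE x in avg_measure P Q. clip 1 (u x) = u x"
    and "density (avg_measure P Q) (\<lambda>x. ennreal (1 + clip 1 (u x))) = P"
    and "density (avg_measure P Q) (\<lambda>x. ennreal (1 - clip 1 (u x))) = Q"
proof -
  interpret P: prob_space P by (rule P)
  interpret Q: prob_space Q by (rule Q)
  define R where "R = sum_measure P Q"
  have emR: "emeasure R A = emeasure P A + emeasure Q A" if "A \<in> sets P" for A
    unfolding R_def using s that by (rule emeasure_sum_measure)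
  have sR: "sets R = sets P" by (simp add: R_def)
  interpret R: finite_measure R
    by standard (use emR[of "space P"] in \<open>simp add: R_def\<close>)
  have mR: "measure R A = measure P A + measure Q A" if "A \<in> sets P" for A
    unfolding measure_def[of R] emR[OF that] P.emeasure_eq_measure Q.emeasure_eq_measure
    by (simp flip: ennreal_plus)
  have ui: "integrable R u"
    and ueq: "\<And>A. A \<in> sets R \<Longrightarrow> measure P A - measure Q A = (LINT x:A|R. u x)"
    using u by (auto simp: is_signed_RN_deriv_def R_def)
  have set_int: "set_integrable R A u" "set_integrable R A (\<lambda>_. 1 :: real)" if "A \<in> sets R" for A
    unfolding set_integrable_def using that ui by (intro integrable_mult_indicator; simp)+
  have one: "(LINT x:A|R. 1 :: real) = measure R A" if "A \<in> sets R" for A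
    using that by (simp add: set_lebesgue_integral_def)
  have neg: "(LINT x:A|R. - u x) = - (LINT x:A|R. u x)" for A
    by (simp add: set_lebesgue_integral_def)
  have "AE x in R. 0 \<le> 1 + u x"
  proof (rule AE_nonneg_if_set_integrals_nonneg)
    fix A assume A: "A \<in> sets R"
    then have "(LINT x:A|R. 1 + u x) = 2 * measure P A"
      using set_int ueq[OF A] one mR sR by (simp add: set_integral_add)
    then show "0 \<le> (LINT x:A|R. 1 + u x)" by simp
  qed (use ui in auto)
  moreover have "AE x in R. 0 \<le> 1 - u x"
  proof (rule AE_nonneg_if_set_integrals_nonneg)
    fix A assume A: "A \<in> sets R"
    then have "(LINT x:A|R. 1 - u x) = 2 * measure Q A"
      using set_int ueq[OF A] one mR sR by (simp add: set_integral_diff)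
    then show "0 \<le> (LINT x:A|R. 1 - u x)" by simp
  qed (use ui in auto)
  ultimately have u1: "AE x in R. \<bar>u x\<bar> \<le> 1"
    by eventually_elim auto
  have "absolutely_continuous R (avg_measure P Q)"
    by (auto simp: absolutely_continuous_def null_sets_def avg_measure_def R_def)
  then have "AE x in avg_measure P Q. \<bar>u x\<bar> \<le> 1"
    by (intro absolutely_continuous_AE[OF _ _ u1]) (auto simp: avg_measure_def R_def)
  then show "AE x in avg_measure P Q. clip 1 (u x) = u x"
    by eventually_elim (auto simp: clip_def)
  show "density (avg_measure P Q) (\<lambda>x. ennreal (1 + clip 1 (u x))) = P"
    unfolding avg_measure_def R_def[symmetric]
    using sR ueq mR u1 ui by (intro half_density_eq R.finite_measure_axioms P.finite_measure_axioms) (auto simp flip: ueq)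
  have "density (scale_measure (1 / 2) R) (\<lambda>x. ennreal (1 + clip 1 (- u x))) = Q"
    using sR mR u1 ui s by (intro half_density_eq R.finite_measure_axioms Q.finite_measure_axioms)
      (auto simp: neg simp flip: ueq)
  moreover have "clip 1 (- x) = - clip 1 x" for x by (auto simp: clip_def)
  ultimately show "density (avg_measure P Q) (\<lambda>x. ennreal (1 - clip 1 (u x))) = Q"
    by (simp add: avg_measure_def R_def)
qed

text \<open>The supremum is attained at the set where \<open>g \<le> f\<close>; half of the \<open>L\<^sup>1\<close> distance lies on either side
  because \<open>f - g\<close> has integral zero.\<close>

lemma total_variation_density:
  fixes f g :: "'a \<Rightarrow> real"
  assumes [measurable]: "f \<in> borel_measurable N" "g \<in> borel_measurable N"
    and f0: "\<And>x. 0 \<le> f x" and g0: "\<And>x. 0 \<le> g x"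
    and f: "prob_space (density N f)" and g: "prob_space (density N g)"
  shows "total_variation (density N f) (density N g) = (\<integral>x. \<bar>f x - g x\<bar> \<partial>N) / 2"
proof -
  have total: "integrable N h \<and> (\<integral>x. h x \<partial>N) = 1"
    if "h \<in> borel_measurable N" "\<And>x. 0 \<le> h x" "prob_space (density N h)" for h :: "'a \<Rightarrow> real"
  proof -
    have "(\<integral>\<^sup>+x. ennreal (h x) \<partial>N) = emeasure (density N h) (space (density N h))"
      using that(1) by (subst emeasure_density) (auto intro!: nn_integral_cong)
    then have nn: "(\<integral>\<^sup>+x. ennreal (h x) \<partial>N) = ennreal 1"
      using prob_space.emeasure_space_1[OF that(3)] by simp
    show ?thesis
      using nn_integral_eq_integrable[THEN iffD1, OF that(1) _ _ nn] that(2) by auto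
  qed
  have fi: "integrable N f" and gi: "integrable N g" and fg: "(\<integral>x. f x - g x \<partial>N) = 0"
    using total[of f] total[of g] f g f0 g0 by auto
  have diff: "measure (density N f) B - measure (density N g) B = (\<integral>x. indicator B x * (f x - g x) \<partial>N)"
    if B: "B \<in> sets N" for B
  proof -
    have m: "measure (density N h) B = (\<integral>x. indicator B x * h x \<partial>N)"
      if "h \<in> borel_measurable N" "\<And>x. 0 \<le> h x" for h :: "'a \<Rightarrow> real"
    proof -
      have "measure (density N h) B = (\<integral>x. indicator B x \<partial>density N h)"
        using B sets.sets_into_space[OF B] by (simp add: Int_absorb2)
      also have "\<dots> = (\<integral>x. indicator B x * h x \<partial>N)"
        using that B by (subst integral_density) (auto simp: mult.commute)
      finally show ?thesis .
    qed
    show ?thesis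
      using integrable_mult_indicator[OF B fi] integrable_mult_indicator[OF B gi] f0 g0
      by (simp add: m right_diff_distrib)
  qed
  define B where "B = {x\<in>space N. g x \<le> f x}"
  have B: "B \<in> sets N" unfolding B_def by measurable
  have half: "(\<integral>x. ((f x - g x) + s * \<bar>f x - g x\<bar>) / 2 \<partial>N) = s * (\<integral>x. \<bar>f x - g x\<bar> \<partial>N) / 2" for s
    using fi gi fg by simp
  have int: "integrable N (\<lambda>x. indicator A x * (f x - g x))" if "A \<in> sets N" for A
    using integrable_mult_indicator[OF that, of "\<lambda>x. f x - g x"] fi gi by simp
  have upper: "\<bar>measure (density N f) A - measure (density N g) A\<bar> \<le> (\<integral>x. \<bar>f x - g x\<bar> \<partial>N) / 2"
    if A: "A \<in> sets N" for A
  proof -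
    have "(\<integral>x. indicator A x * (f x - g x) \<partial>N) \<le> (\<integral>x. ((f x - g x) + 1 * \<bar>f x - g x\<bar>) / 2 \<partial>N)"
      using int[OF A] fi gi by (intro integral_mono) (auto split: split_indicator)
    moreover have "(\<integral>x. ((f x - g x) + (- 1) * \<bar>f x - g x\<bar>) / 2 \<partial>N) \<le> (\<integral>x. indicator A x * (f x - g x) \<partial>N)"
      using int[OF A] fi gi by (intro integral_mono) (auto split: split_indicator)
    ultimately show ?thesis
      unfolding half diff[OF A] by (simp add: abs_le_iff)
  qed
  have "measure (density N f) B - measure (density N g) B = (\<integral>x. ((f x - g x) + 1 * \<bar>f x - g x\<bar>) / 2 \<partial>N)"
    unfolding diff[OF B]
    by (intro Bochner_Integration.integral_cong) (auto simp: B_def split: split_indicator)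
  then have attained: "(\<integral>x. \<bar>f x - g x\<bar> \<partial>N) / 2 \<le> \<bar>measure (density N f) B - measure (density N g) B\<bar>"
    unfolding half by linarith
  have "(SUP A\<in>sets N. \<bar>measure (density N f) A - measure (density N g) A\<bar>) = (\<integral>x. \<bar>f x - g x\<bar> \<partial>N) / 2"
  proof (rule antisym)
    show "(SUP A\<in>sets N. \<bar>measure (density N f) A - measure (density N g) A\<bar>) \<le> (\<integral>x. \<bar>f x - g x\<bar> \<partial>N) / 2"
      using upper B by (intro cSUP_least) auto
    show "(\<integral>x. \<bar>f x - g x\<bar> \<partial>N) / 2 \<le> (SUP A\<in>sets N. \<bar>measure (density N f) A - measure (density N g) A\<bar>)"
      using upper by (intro cSUP_upper2[where x = B] attained B
      bdd_aboveI2[where M = "(\<integral>x. \<bar>f x - g x\<bar> \<partial>N) / 2"]) auto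
  qed
  then show ?thesis by (simp add: total_variation_def)
qed

text \<open>The density is checked on boxes, where both sides factorise. Outside \<open>I\<close> the measures are replaced
  by a point mass, which makes both families sigma-finite at every index.\<close>

lemma PiM_density:
  assumes I: "finite I"
    and M: "\<And>i. i \<in> I \<Longrightarrow> prob_space (M i)"
    and f: "\<And>i. i \<in> I \<Longrightarrow> f i \<in> borel_measurable (M i)"
    and D: "\<And>i. i \<in> I \<Longrightarrow> prob_space (density (M i) (f i))"
  shows "PiM I (\<lambda>i. density (M i) (f i)) = density (PiM I M) (\<lambda>x. \<Prod>i\<in>I. f i (x i))"
proof -
  define M' where "M' i = (if i \<in> I then M i else count_space {undefined})" for i
  define D' where "D' i = (if i \<in> I then density (M i) (f i) else count_space {undefined})" for i
  have pc: "prob_space (count_space {undefined :: 'b})"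
    by (rule prob_spaceI) simp
  interpret M': product_prob_space M' I
    unfolding product_prob_space_def product_sigma_finite_def product_prob_space_axioms_def
    using M pc by (auto simp: M'_def intro: prob_space_imp_sigma_finite)
  interpret D': product_prob_space D' I
    unfolding product_prob_space_def product_sigma_finite_def product_prob_space_axioms_def
    using D pc by (auto simp: D'_def intro: prob_space_imp_sigma_finite)
  have PM: "PiM I M = PiM I M'" and PD: "PiM I (\<lambda>i. density (M i) (f i)) = PiM I D'"
    by (auto intro!: PiM_cong simp: M'_def D'_def)
  have f': "f i \<in> borel_measurable (M' i)" if "i \<in> I" for i
    using f[OF that] that by (simp add: M'_def)
  have "density (PiM I M') (\<lambda>x. \<Prod>i\<in>I. f i (x i)) = PiM I D'"
  proof (rule D'.PiM_eqI[OF I])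
    show "sets (density (PiM I M') (\<lambda>x. \<Prod>i\<in>I. f i (x i))) = PiM I D'"
      by (simp, intro sets_PiM_cong) (auto simp: M'_def D'_def)
    fix A assume A: "\<And>i. i \<in> I \<Longrightarrow> A i \<in> sets (D' i)"
    then have A': "A i \<in> sets (M' i)" if "i \<in> I" for i
      using that A[OF that] by (simp add: M'_def D'_def)
    have meas: "(\<lambda>x. \<Prod>i\<in>I. f i (x i)) \<in> borel_measurable (PiM I M')"
      using f' by measurable
    have "emeasure (density (PiM I M') (\<lambda>x. \<Prod>i\<in>I. f i (x i))) (Pi\<^sub>E I A)
        = (\<integral>\<^sup>+x. (\<Prod>i\<in>I. f i (x i)) * indicator (Pi\<^sub>E I A) x \<partial>PiM I M')"
      using meas A' by (intro emeasure_density sets_PiM_I_finite I) auto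
    also have "\<dots> = (\<integral>\<^sup>+x. (\<Prod>i\<in>I. f i (x i) * indicator (A i) (x i)) \<partial>PiM I M')"
    proof (rule nn_integral_cong)
      fix x assume x: "x \<in> space (PiM I M')"
      have "(\<Prod>i\<in>I. indicator (A i) (x i)) = (indicator (Pi\<^sub>E I A) x :: ennreal)"
        using x I by (auto simp: space_PiM PiE_def Pi_def indicator_def prod_eq_1_iff intro!: prod_zero)
      then show "(\<Prod>i\<in>I. f i (x i)) * indicator (Pi\<^sub>E I A) x = (\<Prod>i\<in>I. f i (x i) * indicator (A i) (x i))"
        by (simp add: prod.distrib)
    qed
    also have "\<dots> = (\<Prod>i\<in>I. \<integral>\<^sup>+x. f i x * indicator (A i) x \<partial>M' i)"
      using f' A' by (intro M'.product_nn_integral_prod I) auto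
    also have "\<dots> = (\<Prod>i\<in>I. emeasure (D' i) (A i))"
    proof (rule prod.cong[OF refl])
      fix i assume i: "i \<in> I"
      show "(\<integral>\<^sup>+x. f i x * indicator (A i) x \<partial>M' i) = emeasure (D' i) (A i)"
        using A'[OF i] f[OF i] i by (simp add: M'_def D'_def emeasure_density)
    qed
    finally show "emeasure (density (PiM I M') (\<lambda>x. \<Prod>i\<in>I. f i (x i))) (Pi\<^sub>E I A) = (\<Prod>i\<in>I. emeasure (D' i) (A i))" .
  qed
  then show ?thesis by (simp add: PM PD)
qed

section \<open>The product measures\<close>

text \<open>The joint law of the \<open>X i\<close> is the product of the averaged measures, so the \<open>L\<^sup>1\<close> distance of the two
  product densities turns into the expectation of \<open>\<bar>gap\<bar>\<close> for \<open>U i = clip 1 \<circ> u i \<circ> X i\<close>. Clipping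
  makes \<open>\<bar>U i\<bar> \<le> 1\<close> hold everywhere, and changes the sum of squares on a null set only.\<close>

lemma product_total_variation_bounds:
  fixes P Q :: "'i \<Rightarrow> 'a measure" and X :: "'i \<Rightarrow> 'b \<Rightarrow> 'a"
  assumes I: "finite I" "I \<noteq> {}"
    and P: "\<And>i. i \<in> I \<Longrightarrow> prob_space (P i)" and Q: "\<And>i. i \<in> I \<Longrightarrow> prob_space (Q i)"
    and s: "\<And>i. i \<in> I \<Longrightarrow> sets (Q i) = sets (P i)"
    and u: "\<And>i. i \<in> I \<Longrightarrow> is_signed_RN_deriv (sum_measure (P i) (Q i)) (P i) (Q i) (u i)"
    and \<Omega>: "prob_space \<Omega>"
    and X: "prob_space.indep_vars \<Omega> (\<lambda>i. avg_measure (P i) (Q i)) X I"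
    and dX: "\<And>i. i \<in> I \<Longrightarrow> distr \<Omega> (avg_measure (P i) (Q i)) (X i) = avg_measure (P i) (Q i)"
  defines "m \<equiv> \<integral>\<omega>. sqrt (\<Sum>i\<in>I. (u i (X i \<omega>))\<^sup>2) \<partial>\<Omega>"
  shows "min 1 m / 21 \<le> total_variation (PiM I P) (PiM I Q)"
    and "total_variation (PiM I P) (PiM I Q) \<le> 9 * min 1 m"
proof -
  interpret \<Omega>: prob_space \<Omega> by (rule \<Omega>)
  define M where "M i = avg_measure (P i) (Q i)" for i
  define v where "v i x = clip 1 (u i x)" for i x
  define U where "U i \<omega> = v i (X i \<omega>)" for i \<omega>
  have pM: "prob_space (M i)" if "i \<in> I" for i
    unfolding M_def using that by (intro prob_space_avg_measure P Q s)
  have u_borel: "u i \<in> borel_measurable (M i)" if "i \<in> I" for i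
  proof -
    have "u i \<in> borel_measurable (sum_measure (P i) (Q i))"
      using u[OF that] by (auto simp: is_signed_RN_deriv_def)
    then show ?thesis
      by (simp add: M_def avg_measure_def cong: measurable_cong_sets)
  qed
  have v_borel [measurable]: "v i \<in> borel_measurable (M i)" if "i \<in> I" for i
    unfolding v_def using u_borel[OF that] by measurable
  have v1: "\<bar>v i x\<bar> \<le> 1" for i x by (simp add: v_def abs_clip_le)
  have v0: "0 \<le> 1 + v i x" "0 \<le> 1 - v i x" for i x using v1[of i x] by auto
  have vu: "AE x in M i. v i x = u i x"
    and dP: "density (M i) (\<lambda>x. ennreal (1 + v i x)) = P i"
    and dQ: "density (M i) (\<lambda>x. ennreal (1 - v i x)) = Q i" if "i \<in> I" for i
    unfolding v_def M_def using that by (intro signed_RN_deriv_densities P Q s u; simp)+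
  have X_meas [measurable]: "X i \<in> \<Omega> \<rightarrow>\<^sub>M M i" if "i \<in> I" for i
    using X that by (auto simp: \<Omega>.indep_vars_def M_def)
  have dX': "distr \<Omega> (M i) (X i) = M i" if "i \<in> I" for i
    using dX[OF that] by (simp add: M_def)
  have EU: "\<Omega>.expectation (U i) = 0" if i: "i \<in> I" for i
  proof -
    interpret Mi: prob_space "M i" by (rule pM[OF i])
    have int: "integrable (M i) (v i)"
      using v1 i by (intro Mi.integrable_const_bound[where B = 1]) auto
    have "(\<integral>\<^sup>+x. ennreal (1 + v i x) \<partial>M i) = emeasure (P i) (space (P i))"
      unfolding dP[OF i, symmetric] using i by (subst emeasure_density) (auto intro!: nn_integral_cong)
    then have "ennreal (\<integral>x. 1 + v i x \<partial>M i) = ennreal 1"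
      using int v0 prob_space.emeasure_space_1[OF P[OF i]] by (subst (asm) nn_integral_eq_integral) auto
    then have "(\<integral>x. 1 + v i x \<partial>M i) = 1"
      using v0 by (subst (asm) ennreal_inj) (auto intro: Bochner_Integration.integral_nonneg)
    then have "(\<integral>x. v i x \<partial>M i) = 0"
      using int by (simp add: Mi.prob_space)
    moreover have "\<Omega>.expectation (U i) = (\<integral>x. v i x \<partial>distr \<Omega> (M i) (X i))"
      unfolding U_def using X_meas[OF i] v_borel[OF i] by (rule integral_distr[symmetric])
    ultimately show ?thesis
      by (simp only: dX'[OF i])
  qed
  have "\<Omega>.indep_vars (\<lambda>_. borel) (\<lambda>i \<omega>. v i (X i \<omega>)) I"
    using X v_borel unfolding M_def[abs_def] by (rule \<Omega>.indep_vars_compose2)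
  then have indep_U: "\<Omega>.indep_vars (\<lambda>_. borel) U I"
    by (simp add: U_def[abs_def])
  interpret U: centred_indep_family \<Omega> U I
  proof
    show "\<bar>U i \<omega>\<bar> \<le> 1" for i \<omega> by (simp add: U_def v1)
  qed (fact I indep_U EU)+
  have "AE \<omega> in \<Omega>. U i \<omega> = u i (X i \<omega>)" if i: "i \<in> I" for i
    unfolding U_def using vu[OF i] by (intro AE_distrD[OF X_meas[OF i]]) (simp only: dX'[OF i])
  then have "AE \<omega> in \<Omega>. \<forall>i\<in>I. U i \<omega> = u i (X i \<omega>)"
    using I by (intro AE_finite_allI) auto
  then have m: "m = U.mean_root"
    unfolding m_def
  proof (intro integral_cong_AE)
    have [measurable]: "(\<lambda>\<omega>. u i (X i \<omega>)) \<in> borel_measurable \<Omega>" if "i \<in> I" for i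
      using X_meas[OF that] u_borel[OF that] by (rule measurable_compose)
    show "(\<lambda>\<omega>. sqrt (\<Sum>i\<in>I. (u i (X i \<omega>))\<^sup>2)) \<in> borel_measurable \<Omega>"
      by measurable
  qed (auto elim!: eventually_mono)
  define N where "N = PiM I M"
  define F where "F x = (\<Prod>i\<in>I. 1 + v i (x i))" for x
  define G where "G x = (\<Prod>i\<in>I. 1 - v i (x i))" for x
  have F_meas [measurable]: "F \<in> borel_measurable N" and G_meas [measurable]: "G \<in> borel_measurable N"
    unfolding F_def G_def N_def by measurable
  have PF: "PiM I P = density N (\<lambda>x. ennreal (F x))"
  proof -
    have "PiM I P = PiM I (\<lambda>i. density (M i) (\<lambda>x. ennreal (1 + v i x)))"
      by (intro PiM_cong) (auto simp: dP)
    also have "\<dots> = density N (\<lambda>x. \<Prod>i\<in>I. ennreal (1 + v i (x i)))"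
      unfolding N_def using I pM P by (intro PiM_density) (auto simp: dP)
    finally show ?thesis using v0 by (simp add: F_def prod_ennreal)
  qed
  have QG: "PiM I Q = density N (\<lambda>x. ennreal (G x))"
  proof -
    have "PiM I Q = PiM I (\<lambda>i. density (M i) (\<lambda>x. ennreal (1 - v i x)))"
      by (intro PiM_cong) (auto simp: dQ)
    also have "\<dots> = density N (\<lambda>x. \<Prod>i\<in>I. ennreal (1 - v i (x i)))"
      unfolding N_def using I pM Q by (intro PiM_density) (auto simp: dQ)
    finally show ?thesis using v0 by (simp add: G_def prod_ennreal)
  qed
  have "total_variation (PiM I P) (PiM I Q) = (\<integral>x. \<bar>F x - G x\<bar> \<partial>N) / 2"
    unfolding PF QG
  proof (rule total_variation_density)
    show "prob_space (density N (\<lambda>x. ennreal (F x)))" "prob_space (density N (\<lambda>x. ennreal (G x)))"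
      unfolding PF[symmetric] QG[symmetric] by (auto intro!: prob_space_PiM P Q)
    show "0 \<le> F x" "0 \<le> G x" for x
      using v0 by (auto simp: F_def G_def intro!: prod_nonneg)
  qed (fact F_meas G_meas)+
  also have "N = distr \<Omega> N (\<lambda>\<omega>. \<lambda>i\<in>I. X i \<omega>)"
  proof -
    have "distr \<Omega> (PiM I M) (\<lambda>\<omega>. \<lambda>i\<in>I. X i \<omega>) = (\<Pi>\<^sub>M i\<in>I. distr \<Omega> (M i) (X i))"
      using X I by (intro \<Omega>.indep_vars_iff_distr_eq_PiM'[THEN iffD1]) (auto simp: M_def[abs_def, symmetric])
    also have "\<dots> = PiM I M" by (intro PiM_cong) (auto simp: dX')
    finally show ?thesis by (simp add: N_def)
  qed
  also have "(\<integral>x. \<bar>F x - G x\<bar> \<partial>distr \<Omega> N (\<lambda>\<omega>. \<lambda>i\<in>I. X i \<omega>)) = \<Omega>.expectation (\<lambda>\<omega>. \<bar>F (\<lambda>i\<in>I. X i \<omega>) - G (\<lambda>i\<in>I. X i \<omega>)\<bar>)"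
  proof (rule integral_distr)
    show "(\<lambda>\<omega>. \<lambda>i\<in>I. X i \<omega>) \<in> \<Omega> \<rightarrow>\<^sub>M N"
      unfolding N_def by (intro measurable_restrict X_meas)
  qed measurable
  also have "\<dots> = \<Omega>.expectation (\<lambda>\<omega>. \<bar>U.gap \<omega>\<bar>)"
    by (simp add: F_def G_def U.gap_def U_def)
  finally have TV: "total_variation (PiM I P) (PiM I Q) = \<Omega>.expectation (\<lambda>\<omega>. \<bar>U.gap \<omega>\<bar>) / 2" .
  show "min 1 m / 21 \<le> total_variation (PiM I P) (PiM I Q)"
    and "total_variation (PiM I P) (PiM I Q) \<le> 9 * min 1 m"
    unfolding TV m using U.expectation_abs_gap_ge U.expectation_abs_gap_le by auto
qed

theorem theorem1p1:
  shows "\<exists>c C :: real. 0 < c \<and> c \<le> C \<and> 1 / 10 ^ 6 \<le> c \<and> C \<le> 10 ^ 6 \<and>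
    (\<forall>(n :: nat) (P :: nat \<Rightarrow> 'a measure) (Q :: nat \<Rightarrow> 'a measure) (u :: nat \<Rightarrow> 'a \<Rightarrow> real)
       (\<Omega> :: 'b measure) (X :: nat \<Rightarrow> 'b \<Rightarrow> 'a).
       n \<ge> 1 \<longrightarrow>
       (\<forall>i\<in>{1..n}. prob_space (P i) \<and> prob_space (Q i) \<and> sets (Q i) = sets (P i)) \<longrightarrow>
       (\<forall>i\<in>{1..n}. is_signed_RN_deriv (sum_measure (P i) (Q i)) (P i) (Q i) (u i)) \<longrightarrow>
       prob_space \<Omega> \<longrightarrow>
       prob_space.indep_vars \<Omega> (\<lambda>i. avg_measure (P i) (Q i)) X {1..n} \<longrightarrow>
       (\<forall>i\<in>{1..n}. distr \<Omega> (avg_measure (P i) (Q i)) (X i) = avg_measure (P i) (Q i)) \<longrightarrow>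
       (let TV = total_variation (PiM {1..n} P) (PiM {1..n} Q);
            E = integral\<^sup>L \<Omega> (\<lambda>\<omega>. sqrt (\<Sum>i=1..n. (u i (X i \<omega>))\<^sup>2))
        in c * min 1 E \<le> TV \<and> TV \<le> C * min 1 E))"
proof (rule exI[of _ "1 / 21"], rule exI[of _ 9], intro conjI allI impI)
  fix n :: nat and P Q :: "nat \<Rightarrow> 'a measure" and u :: "nat \<Rightarrow> 'a \<Rightarrow> real"
    and \<Omega> :: "'b measure" and X :: "nat \<Rightarrow> 'b \<Rightarrow> 'a"
  assume *: "n \<ge> 1"
    "\<forall>i\<in>{1..n}. prob_space (P i) \<and> prob_space (Q i) \<and> sets (Q i) = sets (P i)"
    "\<forall>i\<in>{1..n}. is_signed_RN_deriv (sum_measure (P i) (Q i)) (P i) (Q i) (u i)"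
    "prob_space \<Omega>"
    "prob_space.indep_vars \<Omega> (\<lambda>i. avg_measure (P i) (Q i)) X {1..n}"
    "\<forall>i\<in>{1..n}. distr \<Omega> (avg_measure (P i) (Q i)) (X i) = avg_measure (P i) (Q i)"
  have "min 1 (\<integral>\<omega>. sqrt (\<Sum>i=1..n. (u i (X i \<omega>))\<^sup>2) \<partial>\<Omega>) / 21 \<le> total_variation (PiM {1..n} P) (PiM {1..n} Q)"
    and "total_variation (PiM {1..n} P) (PiM {1..n} Q) \<le> 9 * min 1 (\<integral>\<omega>. sqrt (\<Sum>i=1..n. (u i (X i \<omega>))\<^sup>2) \<partial>\<Omega>)"
    using * by (intro product_total_variation_bounds; auto)+
  then show "let TV = total_variation (PiM {1..n} P) (PiM {1..n} Q);
            E = integral\<^sup>L \<Omega> (\<lambda>\<omega>. sqrt (\<Sum>i=1..n. (u i (X i \<omega>))\<^sup>2))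
        in 1 / 21 * min 1 E \<le> TV \<and> TV \<le> 9 * min 1 E"
    by (simp add: Let_def)
qed simp_all

end
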